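(* There exist constants $\kappa_d>0$ and $c_d\in(0,+\infty)$, depending only on the space dimension $d$ (neither on the domain nor on the initial configuration), such that the following holds. Let $\Omega\subset\mathbb{R}^d$ be a bounded open domain with $C^3$-boundary. Let $N$ identical balls of radius $r>0$ and mass $m>0$ move in $\Omega$ according to Hard Spheres dynamics, the collisions between particles being elastic, those between a particle and the boundary being specular reflections. Denote by $$E=\frac m2\sum_{j=1}^N|u_j(t)|^2$$ the kinetic energy (a constant of the motion), assumed positive, and by $\bar u=\sqrt{2E/(Nm)}$ the root mean square velocity. If $$N\,r\,K(\partial\Omega)<\kappa_d,$$ then for every $t\ge0$, $$\sum_{\rm coll.}^{(t,t+T_f)}|u_{\rm out}-u_{\rm in}|\le c_d\,N^2\,\bar u,\qquad\text{where }T_f:=\frac1{K(\partial\Omega)\,\bar u},$$ the sum running over all the collisions (either between particles, or against the boundary) occurring in the time interval $(t,t+T_f)$.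
   Context: Hard Spheres dynamics: the balls stay in $\Omega$ and do not interpenetrate; each particle $j$ moves with constant velocity $u_j$ between collisions. Collisions between two particles are elastic, conserving linear momentum and kinetic energy (the velocity jump being parallel to the line joining the two centers); a collision of a particle with the boundary $\partial\Omega$ at a contact point $q$ is a specular reflection: the component of the velocity along the normal $\vec n_q$ is reversed, the tangential component is unchanged. At each collision, $u_{\rm out}-u_{\rm in}$ is the change of velocity experienced by a ball at this collision; for a collision between two particles, $|u_{\rm out}-u_{\rm in}|$ is the same for both particles. Standing (generic) assumptions, under which the dynamics is globally defined: collisions happen either between pairs of particles, or between a single particle and the boundary; collisions form a discrete set (they do not accumulate); $r<L(\partial\Omega)$, so that a particle colliding with the boundary has only one contact point with $\partial\Omega$. For a closed $C^3$-hypersurface $\Sigma\subset\mathbb{R}^d$ with unit normal field $\vec\nu$, $L(\Sigma)$ is the largest number $L$ such that every $x\in\mathbb{R}^d$ with $d(x;\Sigma)<L$ admits a unique projection (nearest point) on $\Sigma$, and $$K(\Sigma)=\max\left\{\frac1L\,,\,L\,\|\mathrm{D}^2\vec\nu\|_\infty\right\},\qquad L=L(\Sigma).$$ Here $\mathrm{D}^2\vec\nu_a:T_a\Sigma\times T_a\Sigma\to\mathbb{R}^d$ is the second differential of $\vec\nu:\Sigma\to\mathbb{R}^d$ along $\Sigma$ (the symmetric bilinear map with $\mathrm{D}^2\vec\nu_a(\tau,\tau)=(\vec\nu\circ c)''(0)$ for the geodesic $c$ of $\Sigma$ with $c(0)=a$, $c'(0)=\tau$), and $\|\mathrm{D}^2\vec\nu\|_\infty$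 is the supremum over $a\in\Sigma$ of $|\mathrm{D}^2\vec\nu_a|_{\rm bil}$, where $|B|_{\rm bil}=\sup_{x,y\ne0}|B(x,y)|/(|x||y|)$. *)

theory Defs
  imports "HOL-Analysis.Analysis"
begin

section \<open>Domains with a boundary of class C3\<close>

text \<open>Classical \<open>k\<close>-fold continuous differentiability on an open set, by iterated
  directional derivatives; since the domain is finite-dimensional this agrees with the
  definition by iterated Frechet derivatives.\<close>

fun Ck_on :: "nat \<Rightarrow> 'a::euclidean_space set \<Rightarrow> ('a \<Rightarrow> 'b::real_normed_vector) \<Rightarrow> bool" where
  "Ck_on 0 S f \<longleftrightarrow> continuous_on S f"
| "Ck_on (Suc k) S f \<longleftrightarrow>
     (\<forall>x\<in>S. f differentiable at x) \<and> (\<forall>v. Ck_on k S (\<lambda>x. frechet_derivative f (at x) v))"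

text \<open>Locally, the set is the sublevel set of a C3 function without critical points; in particular
  it lies on one side of its boundary, which is the zero set of that function.\<close>

definition C3_boundary :: "'a::euclidean_space set \<Rightarrow> bool" where
  "C3_boundary \<Omega> \<longleftrightarrow>
     (\<forall>p\<in>frontier \<Omega>. \<exists>U (\<phi> :: 'a \<Rightarrow> real).
        open U \<and> p \<in> U \<and> Ck_on 3 U \<phi> \<and>
        (\<forall>x\<in>U. frechet_derivative \<phi> (at x) \<noteq> (\<lambda>_. 0)) \<and>
        \<Omega> \<inter> U = {x \<in> U. \<phi> x < 0})"

definition tangent_space :: "'a::euclidean_space set \<Rightarrow> 'a \<Rightarrow> 'a set" where
  "tangent_space \<Sigma> a =
     {\<tau>. \<exists>(c :: real \<Rightarrow> 'a) \<epsilon>. \<epsilon> > 0 \<and> (\<forall>t\<in>{-\<epsilon><..<\<epsilon>}. c t \<in> \<Sigma>) \<and> c 0 = a \<and>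
          (c has_vector_derivative \<tau>) (at 0)}"

text \<open>The unit normal of the boundary, oriented outwards. The orientation is immaterial for the
  curvature constant and for specular reflections.\<close>

definition outer_normal :: "'a::euclidean_space set \<Rightarrow> 'a \<Rightarrow> 'a" where
  "outer_normal \<Omega> a =
     (THE n. norm n = 1 \<and> (\<forall>\<tau>\<in>tangent_space (frontier \<Omega>) a. n \<bullet> \<tau> = 0) \<and>
             (\<forall>\<^sub>F s in at_right 0. a + s *\<^sub>R n \<notin> closure \<Omega>))"


section \<open>The geometric constants of a hypersurface\<close>

definition reach :: "'a::euclidean_space set \<Rightarrow> real" where
  "reach \<Sigma> = (GREATEST L. \<forall>x. infdist x \<Sigma> < L \<longrightarrow> (\<exists>!y. y \<in> \<Sigma> \<and> dist x y = infdist x \<Sigma>))"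

definition second_deriv :: "(real \<Rightarrow> 'a::real_normed_vector) \<Rightarrow> real \<Rightarrow> 'a" where
  "second_deriv c t = vector_derivative (\<lambda>s. vector_derivative c (at s)) (at t)"

text \<open>Geodesics parametrized proportionally to arc length: the acceleration is normal to \<open>\<Sigma>\<close>.\<close>

definition geodesic :: "'a::euclidean_space set \<Rightarrow> real \<Rightarrow> (real \<Rightarrow> 'a) \<Rightarrow> bool" where
  "geodesic \<Sigma> \<epsilon> c \<longleftrightarrow>
     \<epsilon> > 0 \<and> Ck_on 2 {-\<epsilon><..<\<epsilon>} c \<and>
     (\<forall>t\<in>{-\<epsilon><..<\<epsilon>}. c t \<in> \<Sigma> \<and> (\<forall>\<tau>\<in>tangent_space \<Sigma> (c t). second_deriv c t \<bullet> \<tau> = 0))"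

text \<open>The bilinear map is defined on the whole space, but only its restriction to the tangent space
  \<open>T\<^sub>a\<Sigma>\<close> is determined (by polarization), and only this restriction is used.\<close>

definition second_differential ::
    "'a::euclidean_space set \<Rightarrow> ('a \<Rightarrow> 'a) \<Rightarrow> 'a \<Rightarrow> 'a \<Rightarrow> 'a \<Rightarrow> 'a" where
  "second_differential \<Sigma> \<nu> a =
     (SOME B. bilinear B \<and> (\<forall>x y. B x y = B y x) \<and>
        (\<forall>\<tau>\<in>tangent_space \<Sigma> a. \<forall>\<epsilon> c.
           geodesic \<Sigma> \<epsilon> c \<and> c 0 = a \<and> vector_derivative c (at 0) = \<tau>
             \<longrightarrow> B \<tau> \<tau> = second_deriv (\<nu> \<circ> c) 0))"

text \<open>Pairs with a zero vector only contribute the value 0, since \<open>x / 0 = 0\<close>; they make the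
  set nonempty also when \<open>T = {0}\<close>, i.e. in space dimension one.\<close>

definition bil_norm :: "'a::euclidean_space set \<Rightarrow> ('a \<Rightarrow> 'a \<Rightarrow> 'a) \<Rightarrow> real" where
  "bil_norm T B = Sup {norm (B x y) / (norm x * norm y) | x y. x \<in> T \<and> y \<in> T}"

text \<open>For a compact C3 hypersurface the supremum is over a nonempty bounded set of reals.\<close>

definition K_const :: "'a::euclidean_space set \<Rightarrow> ('a \<Rightarrow> 'a) \<Rightarrow> real" where
  "K_const \<Sigma> \<nu> =
     max (1 / reach \<Sigma>)
         (reach \<Sigma> * (SUP a\<in>\<Sigma>. bil_norm (tangent_space \<Sigma> a) (second_differential \<Sigma> \<nu> a)))"


section \<open>Hard spheres dynamics\<close>

text \<open>The particles are numbered \<open>0, \<dots>, N - 1\<close>; \<open>x j t\<close> is the center of particle \<open>j\<close> at time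
  \<open>t\<close> and \<open>u j t\<close> its velocity. Velocities are right-continuous: at a collision time \<open>s\<close>, the
  value \<open>u j s\<close> is the outgoing velocity, and the incoming one is the limit from the left.\<close>

definition u_in :: "(nat \<Rightarrow> real \<Rightarrow> 'a::euclidean_space) \<Rightarrow> nat \<Rightarrow> real \<Rightarrow> 'a" where
  "u_in u j s = Lim (at_left s) (u j)"

definition pair_collision :: "real \<Rightarrow> (nat \<Rightarrow> real \<Rightarrow> 'a::euclidean_space) \<Rightarrow> nat \<Rightarrow> nat \<Rightarrow> real \<Rightarrow> bool" where
  "pair_collision r x i j s \<longleftrightarrow> i \<noteq> j \<and> dist (x i s) (x j s) = 2 * r"

definition contact_point ::
    "'a::euclidean_space set \<Rightarrow> real \<Rightarrow> (nat \<Rightarrow> real \<Rightarrow> 'a) \<Rightarrow> nat \<Rightarrow> real \<Rightarrow> 'a \<Rightarrow> bool" where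
  "contact_point \<Omega> r x j s q \<longleftrightarrow> q \<in> frontier \<Omega> \<and> dist (x j s) q = r"

definition wall_collision ::
    "'a::euclidean_space set \<Rightarrow> real \<Rightarrow> (nat \<Rightarrow> real \<Rightarrow> 'a) \<Rightarrow> nat \<Rightarrow> real \<Rightarrow> bool" where
  "wall_collision \<Omega> r x j s \<longleftrightarrow> (\<exists>q. contact_point \<Omega> r x j s q)"

definition collides ::
    "'a::euclidean_space set \<Rightarrow> nat \<Rightarrow> real \<Rightarrow> (nat \<Rightarrow> real \<Rightarrow> 'a) \<Rightarrow> nat \<Rightarrow> real \<Rightarrow> bool" where
  "collides \<Omega> N r x j s \<longleftrightarrow> (\<exists>i<N. pair_collision r x i j s) \<or> wall_collision \<Omega> r x j s"

text \<open>Conservation of momentum and energy (the common mass cancels); the velocity jump is parallel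
  to the line of centers. A nonzero jump for approaching particles is then enforced by
  non-interpenetration.\<close>

definition elastic_law ::
    "(nat \<Rightarrow> real \<Rightarrow> 'a::euclidean_space) \<Rightarrow> (nat \<Rightarrow> real \<Rightarrow> 'a) \<Rightarrow> nat \<Rightarrow> nat \<Rightarrow> real \<Rightarrow> bool" where
  "elastic_law x u i j s \<longleftrightarrow>
     u i s + u j s = u_in u i s + u_in u j s \<and>
     (norm (u i s))\<^sup>2 + (norm (u j s))\<^sup>2 = (norm (u_in u i s))\<^sup>2 + (norm (u_in u j s))\<^sup>2 \<and>
     (\<exists>\<alpha>. u i s - u_in u i s = \<alpha> *\<^sub>R (x i s - x j s))"

definition specular_law :: "(nat \<Rightarrow> real \<Rightarrow> 'a::euclidean_space) \<Rightarrow> nat \<Rightarrow> real \<Rightarrow> 'a \<Rightarrow> bool" where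
  "specular_law u j s n \<longleftrightarrow>
     u j s \<bullet> n = - (u_in u j s \<bullet> n) \<and>
     u j s - (u j s \<bullet> n) *\<^sub>R n = u_in u j s - (u_in u j s \<bullet> n) *\<^sub>R n"

definition hard_spheres ::
    "'a::euclidean_space set \<Rightarrow> nat \<Rightarrow> real \<Rightarrow> (nat \<Rightarrow> real \<Rightarrow> 'a) \<Rightarrow> (nat \<Rightarrow> real \<Rightarrow> 'a) \<Rightarrow> bool" where
  "hard_spheres \<Omega> N r x u \<longleftrightarrow>
     (\<forall>t\<ge>0. \<forall>j<N. ball (x j t) r \<subseteq> \<Omega>) \<and>
     (\<forall>t\<ge>0. \<forall>i<N. \<forall>j<N. i \<noteq> j \<longrightarrow> dist (x i t) (x j t) \<ge> 2 * r) \<and>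
     (\<forall>j<N. \<forall>a b. 0 \<le> a \<and> a \<le> b \<and> (\<forall>s\<in>{a<..<b}. \<not> collides \<Omega> N r x j s) \<longrightarrow>
        x j b = x j a + (b - a) *\<^sub>R u j a \<and>
        (\<not> collides \<Omega> N r x j b \<longrightarrow> u j b = u j a)) \<and>
     (\<forall>s>0. \<forall>i<N. \<forall>j<N. pair_collision r x i j s \<longrightarrow> elastic_law x u i j s) \<and>
     (\<forall>s>0. \<forall>j<N. \<forall>q. contact_point \<Omega> r x j s q \<longrightarrow> specular_law u j s (outer_normal \<Omega> q))"

text \<open>The generic assumptions: collision times do not accumulate, and at any given time a particle
  takes part in at most one collision.\<close>

definition generic_collisions ::
    "'a::euclidean_space set \<Rightarrow> nat \<Rightarrow> real \<Rightarrow> (nat \<Rightarrow> real \<Rightarrow> 'a) \<Rightarrow> bool" where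
  "generic_collisions \<Omega> N r x \<longleftrightarrow>
     (\<forall>T. finite {s\<in>{0<..T}. \<exists>j<N. collides \<Omega> N r x j s}) \<and>
     (\<forall>s>0. \<forall>i<N. \<forall>j<N. \<forall>k<N. pair_collision r x i j s \<and> pair_collision r x k j s \<longrightarrow> i = k) \<and>
     (\<forall>s>0. \<forall>i<N. \<forall>j<N. pair_collision r x i j s \<longrightarrow> \<not> wall_collision \<Omega> r x j s)"

definition kinetic_energy :: "real \<Rightarrow> nat \<Rightarrow> (nat \<Rightarrow> real \<Rightarrow> 'a::euclidean_space) \<Rightarrow> real \<Rightarrow> real" where
  "kinetic_energy m N u t = m / 2 * (\<Sum>j<N. (norm (u j t))\<^sup>2)"

text \<open>The sum of \<open>|u\<^sub>o\<^sub>u\<^sub>t - u\<^sub>i\<^sub>n|\<close> over the collisions in the open time interval \<open>(t, t')\<close>. A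
  collision between two particles is counted once (\<open>i < j\<close>), the jump being read off from
  particle \<open>i\<close>; by momentum conservation that of \<open>j\<close> has the same norm.\<close>

definition collision_sum ::
    "'a::euclidean_space set \<Rightarrow> nat \<Rightarrow> real \<Rightarrow> (nat \<Rightarrow> real \<Rightarrow> 'a) \<Rightarrow> (nat \<Rightarrow> real \<Rightarrow> 'a) \<Rightarrow>
     real \<Rightarrow> real \<Rightarrow> real" where
  "collision_sum \<Omega> N r x u t t' =
     (\<Sum>(i, j, s)\<in>{(i, j, s). i < j \<and> j < N \<and> t < s \<and> s < t' \<and> pair_collision r x i j s}.
        norm (u i s - u_in u i s)) +
     (\<Sum>(j, s)\<in>{(j, s). j < N \<and> t < s \<and> s < t' \<and> wall_collision \<Omega> r x j s}.
        norm (u j s - u_in u j s))"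

end

theory Submission
  imports Defs
begin

text \<open>The proof follows one scalar quantity, a virial. For particles at \<open>x\<^sub>i\<close> with velocities \<open>u\<^sub>i\<close>
put
\<open>F = (\<Sum>i. u\<^sub>i \<bullet> ((\<Sum>k. sgn (x\<^sub>i - x\<^sub>k)) + 2 N V(x\<^sub>i)))\<close>,
where \<open>V\<close> is a vector field that equals the inward unit normal at the centers of balls touching
the boundary.

The first part of the field is the gradient, with respect to the positions, of the sum of the mutual
distances of the particles. The distance is a convex function, so its gradient \<open>sgn\<close> is
monotone (\<open>sgn_monotone\<close>). This has two consequences. Along straight flight the first
part of \<open>F\<close> does not decrease (\<open>repulsion_free_flight\<close>). At a collision of
\<open>i\<close> with \<open>j\<close> the velocity jump of \<open>i\<close> is a nonnegative
multiple of \<open>x\<^sub>i - x\<^sub>j\<close>, and the first part increases by at least twice the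
norm of that jump, whatever the positions of the other particles
(\<open>repulsion_collision\<close>). Only a collision with the boundary can decrease it, by at most
\<open>N\<close> times the jump, and there the second part gains \<open>2 N\<close> times the jump,
because this jump is a nonnegative multiple of \<open>V\<close>.

The price of the second part is governed by the Lipschitz constant \<open>\<Lambda>\<close> of
\<open>V\<close>. At a collision of two particles it loses at most \<open>2 N \<Lambda> 2 r\<close>
times the jump, which is harmless when \<open>N r \<Lambda>\<close> is small. During a flight of
duration \<open>T\<close> it loses at most \<open>2 N \<Lambda> T (\<Sum>i. |u\<^sub>i|\<^sup>2)\<close>. Altogether every jump is dominated by the increase of \<open>F\<close>
at its collision. Since \<open>|F|\<close> is of order \<open>N\<^sup>2\<close> times the root mean
square velocity, and the loss during flight has the same order over a time \<open>T\<^sub>f\<close>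
if \<open>\<Lambda>\<close> is of order \<open>K\<close>, the bound follows
(\<open>collision_sum_le\<close>).

It remains to construct \<open>V\<close> with a Lipschitz constant comparable to \<open>1 / L\<close>, where \<open>L\<close> is the reach of the boundary, hence at most of order
\<open>K\<close> (\<open>inward_normal_field\<close>). The reach provides, at each contact point,
balls of every radius below \<open>L\<close> that are tangent to the boundary from inside and from
outside (\<open>tangent_balls\<close>). That inner and outer balls at two different boundary points
are disjoint forces the normals to be Lipschitz with constant of order \<open>1 / L\<close>
(\<open>normals_lipschitz\<close>). The tangent balls also identify the outer normal of the boundary
(\<open>outer_normal_eq\<close>). Finally the normals, transported to the centers of the touching
balls, are extended to the whole space.\<close>

section \<open>Normal segments and unique projections\<close>

text \<open>The condition on \<open>L\<close> that is maximized in the definition of the reach.\<close>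

definition unique_projection :: "'a::euclidean_space set \<Rightarrow> real \<Rightarrow> bool" where
  "unique_projection S L \<longleftrightarrow>
     (\<forall>x. infdist x S < L \<longrightarrow> (\<exists>!y. y \<in> S \<and> dist x y = infdist x S))"

text \<open>Uniqueness of the nearest point makes the graph of the projection an intersection of closed
  sets, and a closed graph with compact target means continuity.\<close>

lemma continuous_on_projection:
  fixes S :: "'a::euclidean_space set"
  assumes "compact S" "closed D"
    and p: "\<And>x. x \<in> D \<Longrightarrow> p x \<in> S \<and> dist x (p x) = infdist x S"
    and uniq: "\<And>x. x \<in> D \<Longrightarrow> \<exists>!y. y \<in> S \<and> dist x y = infdist x S"
  shows "continuous_on D p"
proof (rule continuous_from_closed_graph[OF \<open>compact S\<close>])
  show "p \<in> D \<rightarrow> S" using p by auto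
  have "(\<lambda>x. (x, p x)) ` D = (D \<times> S) \<inter> {z. dist (fst z) (snd z) = infdist (fst z) S}"
    using p uniq by (fastforce simp: image_iff)
  moreover have "closed {z::'a\<times>'a. dist (fst z) (snd z) = infdist (fst z) S}"
    by (intro closed_Collect_eq continuous_intros)
  ultimately show "closed ((\<lambda>x. (x, p x)) ` D)"
    using assms by (simp add: closed_Int closed_Times compact_imp_closed)
qed

text \<open>If a point at distance \<open>r\<close> from \<open>S\<close> projects to \<open>q\<close>, then so do the points further away on the
  same ray, as long as their distance is below \<open>L\<close>. To pass from distance \<open>r\<close> to distance \<open>s\<close>
  at one stroke, look for a point \<open>z\<close> at distance \<open>s - r\<close> from \<open>x0 = q + r *\<^sub>R n\<close> such that \<open>x0\<close> lies
  on the segment from \<open>z\<close> to its projection. Such a \<open>z\<close> is a fixed point of a continuous map of a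
  ball into itself. Every point of that segment has the same projection as \<open>z\<close>, so the
  projection of \<open>z\<close> is that of \<open>x0\<close>, namely \<open>q\<close>.\<close>

lemma normal_ball_extends:
  fixes S :: "'a::euclidean_space set"
  assumes S: "compact S" and uniq: "unique_projection S L"
    and q: "q \<in> S" and n: "norm n = 1" and r: "0 < r" "r < L"
    and avoid: "ball (q + r *\<^sub>R n) r \<inter> S = {}" and s: "s < L"
  shows "ball (q + s *\<^sub>R n) s \<inter> S = {}"
proof (cases "s \<le> r")
  case True
  have "dist (q + s *\<^sub>R n) (q + r *\<^sub>R n) = r - s"
    using True n by (simp add: dist_norm flip: scaleR_left_diff_distrib)
  then have "ball (q + s *\<^sub>R n) s \<subseteq> ball (q + r *\<^sub>R n) r"
    by (simp add: ball_subset_ball_iff)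
  then show ?thesis using avoid by blast
next
  case False
  define x0 where "x0 = q + r *\<^sub>R n"
  define \<epsilon> where "\<epsilon> = s - r"
  have "\<epsilon> > 0" using False by (simp add: \<epsilon>_def)
  have far: "r \<le> dist x0 y" if "y \<in> S" for y
    using avoid that by (force simp: x0_def not_less[symmetric])
  have dq: "dist x0 q = r" using n r by (simp add: x0_def dist_norm)
  have inf0: "infdist x0 S = r"
    using infdist_le[OF q, of x0] dq far q
    by (metis S antisym compact_imp_closed empty_iff infdist_attains_inf)
  have close: "infdist z S < L" if "z \<in> cball x0 \<epsilon>" for z
    using infdist_triangle[of z S x0] inf0 that s by (simp add: \<epsilon>_def dist_commute)
  define p where "p x = (SOME y. y \<in> S \<and> dist x y = infdist x S)" for x
  have p: "p z \<in> S" "dist z (p z) = infdist z S" for z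
  proof -
    have "\<exists>y. y \<in> S \<and> dist z y = infdist z S"
      using S q by (metis compact_imp_closed empty_iff infdist_attains_inf)
    then have "p z \<in> S \<and> dist z (p z) = infdist z S" unfolding p_def by (rule someI_ex)
    then show "p z \<in> S" "dist z (p z) = infdist z S" by auto
  qed
  have "continuous_on (cball x0 \<epsilon>) p"
    using S p close uniq
    by (intro continuous_on_projection[where S=S]) (auto simp: unique_projection_def)
  moreover have x0p: "x0 - p z \<noteq> 0" for z
    using far[OF p(1)[of z]] r by auto
  ultimately have cont: "continuous_on (cball x0 \<epsilon>) (\<lambda>z. x0 + \<epsilon> *\<^sub>R sgn (x0 - p z))"
    by (intro continuous_intros) auto
  obtain z where z: "z \<in> cball x0 \<epsilon>" "x0 + \<epsilon> *\<^sub>R sgn (x0 - p z) = z"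
    by (rule brouwer_ball[OF \<open>\<epsilon> > 0\<close> cont]) (use \<open>\<epsilon> > 0\<close> in \<open>auto simp: dist_norm norm_sgn\<close>)
  define \<rho> where "\<rho> = norm (x0 - p z)"
  define e where "e = sgn (x0 - p z)"
  have e: "norm e = 1" "x0 - p z = \<rho> *\<^sub>R e"
    using x0p[of z] by (auto simp: e_def \<rho>_def norm_sgn sgn_div_norm)
  have "z - p z = (\<rho> + \<epsilon>) *\<^sub>R e"
  proof -
    have "z - p z = (x0 - p z) + \<epsilon> *\<^sub>R e" using z(2) by (simp add: e_def algebra_simps)
    then show ?thesis unfolding e(2) by (simp add: scaleR_left_distrib)
  qed
  moreover have "\<rho> \<ge> 0" by (simp add: \<rho>_def)
  ultimately have infz: "infdist z S = \<rho> + \<epsilon>"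
    using p(2)[of z] e(1) \<open>\<epsilon> > 0\<close> by (simp add: dist_norm)
  \<comment> \<open>The ball around \<open>x0\<close> through \<open>p z\<close> is contained in the ball around \<open>z\<close> through \<open>p z\<close>.\<close>
  have "\<rho> \<le> dist x0 y" if "y \<in> S" for y
  proof -
    have "\<rho> + \<epsilon> \<le> dist z y" using infz infdist_le[OF that, of z] by simp
    also have "\<dots> \<le> dist x0 y + \<epsilon>" using dist_triangle[of z y x0] z(1) by (simp add: dist_commute)
    finally show ?thesis by simp
  qed
  then have "\<rho> \<le> r" using q dq by force
  moreover have "infdist x0 S \<le> \<rho>" using infdist_le[OF p(1), of x0 z] by (simp add: \<rho>_def dist_norm)
  ultimately have "\<rho> = r" using inf0 by simp
  then have "p z = q"
    using uniq inf0 r dq q p(1)[of z] \<rho>_def unfolding unique_projection_def dist_norm by metis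
  then have "z = q + s *\<^sub>R n"
    using z(2) r n \<open>\<epsilon> > 0\<close> by (simp add: x0_def \<epsilon>_def sgn_div_norm algebra_simps)
  moreover have "infdist z S = s" using infz \<open>\<rho> = r\<close> by (simp add: \<epsilon>_def)
  ultimately show ?thesis using infdist_le[of _ S z] by force
qed

section \<open>Tangent balls on both sides of the boundary\<close>

lemma differentiable_imp_locally_bounded_increment:
  fixes f :: "'a::real_normed_vector \<Rightarrow> 'b::real_normed_vector"
  assumes "f differentiable at q"
  shows "\<exists>C\<ge>0. \<forall>\<^sub>F x in nhds q. norm (f x - f q) \<le> C * norm (x - q)"
proof -
  obtain f' where f': "(f has_derivative f') (at q)" using assms by (auto simp: differentiable_def)
  then obtain B where B: "\<And>h. norm (f' h) \<le> norm h * B" "B > 0"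
    by (meson bounded_linear.pos_bounded has_derivative_bounded_linear)
  from f' obtain \<delta> where \<delta>: "\<delta> > 0" "\<And>y. norm (y - q) < \<delta> \<Longrightarrow> norm (f y - f q - f' (y - q)) \<le> 1 * norm (y - q)"
    unfolding has_derivative_at_alt using zero_less_one by blast
  have "norm (f y - f q) \<le> (B + 1) * norm (y - q)" if "dist y q < \<delta>" for y
  proof -
    have "norm (f y - f q) \<le> norm (f y - f q - f' (y - q)) + norm (f' (y - q))"
      using norm_triangle_ineq[of "f y - f q - f' (y - q)" "f' (y - q)"] by simp
    also have "\<dots> \<le> 1 * norm (y - q) + norm (y - q) * B"
      using \<delta>(2)[of y] that B(1) by (intro add_mono) (auto simp: dist_norm)
    finally show ?thesis by (simp add: algebra_simps)
  qed
  then show ?thesis using \<delta>(1) B(2)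
    by (intro exI[of _ "B+1"]) (auto simp: eventually_nhds_metric)
qed

text \<open>The remainder in the mean value theorem is quadratic because the first partial derivatives, being
  differentiable at \<open>q\<close>, deviate at most linearly from their values at \<open>q\<close>.\<close>

lemma quadratic_lower_bound:
  fixes \<phi> :: "'a::euclidean_space \<Rightarrow> real"
  assumes "open U" "q \<in> U" "Ck_on (Suc (Suc k)) U \<phi>"
  shows "\<exists>C\<ge>0. \<exists>\<delta>>0. ball q \<delta> \<subseteq> U \<and> (\<forall>y\<in>ball q \<delta>.
           \<phi> q + frechet_derivative \<phi> (at q) (y - q) - C * (norm (y - q))\<^sup>2 \<le> \<phi> y)"
proof -
  define D where "D x v = frechet_derivative \<phi> (at x) v" for x v
  have der: "(\<phi> has_derivative D x) (at x)" if "x \<in> U" for x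
    using assms(3) that by (simp add: D_def[abs_def] frechet_derivative_works[symmetric])
  have "(\<lambda>x. D x b) differentiable at q" for b
    using assms(2,3) by (simp add: D_def)
  then have "\<forall>b. \<exists>C\<ge>0. \<forall>\<^sub>F x in nhds q. norm (D x b - D q b) \<le> C * norm (x - q)"
    by (intro allI differentiable_imp_locally_bounded_increment)
  then obtain C where C: "\<And>b. C b \<ge> 0"
      "\<And>b. \<forall>\<^sub>F x in nhds q. norm (D x b - D q b) \<le> C b * norm (x - q)" by metis
  have "\<forall>\<^sub>F x in nhds q. (\<forall>b\<in>Basis. norm (D x b - D q b) \<le> C b * norm (x - q)) \<and> x \<in> U"
    using C(2) assms(1,2) by (intro eventually_conj eventually_ball_finite eventually_nhds_in_open) auto
  then obtain \<delta> where \<delta>: "\<delta> > 0"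
      "\<And>x. dist x q < \<delta> \<Longrightarrow> (\<forall>b\<in>Basis. norm (D x b - D q b) \<le> C b * norm (x - q)) \<and> x \<in> U"
    unfolding eventually_nhds_metric by blast
  define B where "B = (\<Sum>b\<in>Basis. C b)"
  have bound: "\<bar>D x h - D q h\<bar> \<le> B * norm (x - q) * norm h" if "dist x q < \<delta>" for x h
  proof -
    have "linear (D z)" if "z \<in> U" for z
      using der[OF that] has_derivative_linear by blast
    moreover have "x \<in> U" using \<delta>(2)[OF that] by blast
    ultimately have lin: "linear (\<lambda>h. D x h - D q h)"
      using assms(2) by (intro linear_compose_sub)
    have "D x h - D q h = (\<lambda>h. D x h - D q h) (\<Sum>b\<in>Basis. (h \<bullet> b) *\<^sub>R b)"
      by (simp add: euclidean_representation)
    also have "\<dots> = (\<Sum>b\<in>Basis. (h \<bullet> b) * (D x b - D q b))"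
      unfolding linear_sum[OF lin] linear_cmul[OF lin] real_scaleR_def ..
    also have "\<bar>\<dots>\<bar> \<le> (\<Sum>b\<in>Basis. norm h * (C b * norm (x - q)))"
      using \<delta>(2)[OF that] C(1)
      by (intro order_trans[OF sum_abs] sum_mono) (auto simp: abs_mult Basis_le_norm intro!: mult_mono)
    also have "\<dots> = B * norm (x - q) * norm h"
      by (simp add: B_def sum_distrib_left sum_distrib_right mult_ac)
    finally show ?thesis .
  qed
  have "\<phi> q + D q (y - q) - B * (norm (y - q))\<^sup>2 \<le> \<phi> y" if y: "y \<in> ball q \<delta>" for y
  proof -
    have seg: "dist (q + t *\<^sub>R (y - q)) q < \<delta>" "norm (t *\<^sub>R (y - q)) \<le> norm (y - q)" if "0 \<le> t" "t \<le> 1" for t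
    proof -
      show 1: "norm (t *\<^sub>R (y - q)) \<le> norm (y - q)"
        using that by (simp add: mult_left_le_one_le)
      show "dist (q + t *\<^sub>R (y - q)) q < \<delta>"
        using 1 y by (auto simp: dist_norm norm_minus_commute)
    qed
    have "\<exists>t\<in>{0<..<1}. \<phi> (q + 1 *\<^sub>R (y - q)) - \<phi> (q + 0 *\<^sub>R (y - q)) = D (q + t *\<^sub>R (y - q)) ((1 - 0) *\<^sub>R (y - q))"
    proof (rule mvt_simple)
      fix t :: real assume "0 \<le> t" "t \<le> 1"
      then have "q + t *\<^sub>R (y - q) \<in> U" using seg \<delta>(2) by blast
      then have 1: "(\<phi> has_derivative D (q + t *\<^sub>R (y - q))) (at (q + t *\<^sub>R (y - q)))" by (rule der)
      show "((\<lambda>t. \<phi> (q + t *\<^sub>R (y - q))) has_derivative (\<lambda>x. D (q + t *\<^sub>R (y - q)) (x *\<^sub>R (y - q)))) (at t within {0..1})"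
        by (rule has_derivative_compose[where f="\<lambda>t. q + t *\<^sub>R (y - q)", OF _ 1])
          (auto intro!: derivative_eq_intros)
    qed simp
    then obtain t where t: "0 < t" "t < 1" "\<phi> y - \<phi> q = D (q + t *\<^sub>R (y - q)) (y - q)" by auto
    have "\<bar>D (q + t *\<^sub>R (y - q)) (y - q) - D q (y - q)\<bar> \<le> B * norm (q + t *\<^sub>R (y - q) - q) * norm (y - q)"
      using t seg by (intro bound) auto
    also have "\<dots> \<le> B * norm (y - q) * norm (y - q)"
      using seg(2)[of t] t C(1) by (intro mult_mono) (auto simp: B_def sum_nonneg)
    finally show ?thesis using t(3) by (simp add: power2_eq_square abs_le_iff algebra_simps)
  qed
  moreover have "B \<ge> 0" using C(1) by (simp add: B_def sum_nonneg)
  moreover have "ball q \<delta> \<subseteq> U" using \<delta>(2) by (auto simp: dist_commute)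
  ultimately show ?thesis using \<delta>(1) unfolding D_def by blast
qed

text \<open>The defining function \<open>\<phi>\<close> is negative in the inner ball, so its differential at \<open>q\<close>, which does
  not vanish, is a negative multiple of \<open>\<lambda>v. v \<bullet> n\<close>. In a ball of radius \<open>s\<close> tangent from the
  other side, a displacement \<open>h\<close> from \<open>q\<close> satisfies \<open>- (h \<bullet> n) > |h|\<^sup>2 / (2 s)\<close>: for small \<open>s\<close> the
  linear term of \<open>\<phi>\<close> dominates the quadratic error.\<close>

lemma exterior_ball:
  fixes \<Omega> :: "'a::euclidean_space set"
  assumes "open \<Omega>" "C3_boundary \<Omega>" and q: "q \<in> frontier \<Omega>" and n: "norm n = 1"
    and r: "r > 0" and inside: "ball (q + r *\<^sub>R n) r \<subseteq> \<Omega>"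
  shows "\<exists>s0>0. \<forall>s. 0 < s \<and> s \<le> s0 \<longrightarrow> ball (q - s *\<^sub>R n) s \<inter> closure \<Omega> = {}"
proof -
  from assms(2) q obtain U and \<phi> :: "'a \<Rightarrow> real" where U: "open U" "q \<in> U" and C3: "Ck_on 3 U \<phi>"
    and nz: "frechet_derivative \<phi> (at q) \<noteq> (\<lambda>_. 0)" and \<Omega>: "\<Omega> \<inter> U = {x \<in> U. \<phi> x < 0}"
    unfolding C3_boundary_def by blast
  have C2: "Ck_on (Suc (Suc 1)) U \<phi>" using C3 by (simp only: numeral_3_eq_3 One_nat_def)
  define l where "l = frechet_derivative \<phi> (at q)"
  have der: "(\<phi> has_derivative l) (at q)"
    using C2 U(2) by (simp add: l_def frechet_derivative_works[symmetric])
  then have lin: "linear l" by (rule has_derivative_linear)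
  have "q \<notin> \<Omega>" using q \<open>open \<Omega>\<close> by (simp add: frontier_def interior_open)
  then have phiq: "\<phi> q \<ge> 0" using \<Omega> U(2) by force
  have le1: "l v \<le> 0" if v: "v \<bullet> n > 0" for v
  proof -
    have "((\<lambda>t. q + t *\<^sub>R v) has_derivative (\<lambda>t. t *\<^sub>R v)) (at 0)"
      by (auto intro!: derivative_eq_intros)
    from has_derivative_compose[OF this, of \<phi> l] der
    have "((\<lambda>t. \<phi> (q + t *\<^sub>R v)) has_derivative (\<lambda>t. l (t *\<^sub>R v))) (at 0)" by simp
    then have drv: "((\<lambda>t. \<phi> (q + t *\<^sub>R v)) has_real_derivative l v) (at 0)"
      by (simp add: has_field_derivative_def linear_cmul[OF lin] mult.commute[of _ "l v"])
    have "\<not> l v > 0"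
    proof
      assume "l v > 0"
      then obtain d where d: "d > 0" "\<And>h. 0 < h \<Longrightarrow> h < d \<Longrightarrow> \<phi> (q + 0 *\<^sub>R v) < \<phi> (q + (0 + h) *\<^sub>R v)"
        using DERIV_pos_inc_right[OF drv] by blast
      have "((\<lambda>h. q + h *\<^sub>R v) \<longlongrightarrow> q + 0 *\<^sub>R v) (at_right 0)"
        by (intro tendsto_intros)
      then have "\<forall>\<^sub>F h in at_right 0. q + h *\<^sub>R v \<in> U"
        using U by (intro topological_tendstoD) auto
      moreover have "\<forall>\<^sub>F h in at_right 0. h < d" "\<forall>\<^sub>F h in at_right (0::real). 0 < h"
        using d(1) by (auto intro: eventually_at_right_less eventually_at_rightI[of 0 d])
      moreover
      have "((\<lambda>h. h * (v \<bullet> v)) \<longlongrightarrow> 0 * (v \<bullet> v)) (at_right 0)"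
        by (intro tendsto_intros)
      then have "\<forall>\<^sub>F h in at_right 0. h * (v \<bullet> v) < 2 * r * (v \<bullet> n)"
        using r v by (intro order_tendstoD(2)) auto
      ultimately have "\<forall>\<^sub>F h in at_right 0. q + h *\<^sub>R v \<in> U \<and> h < d \<and> 0 < h \<and> h * (v \<bullet> v) < 2 * r * (v \<bullet> n)"
        by (intro eventually_conj)
      then obtain h where elim: "q + h *\<^sub>R v \<in> U" "h < d" "0 < h" "h * (v \<bullet> v) < 2 * r * (v \<bullet> n)"
        using eventually_happens'[OF trivial_limit_at_right_real] by blast
        have "(norm (h *\<^sub>R v - r *\<^sub>R n))\<^sup>2 = h * (h * (v \<bullet> v) - 2 * r * (v \<bullet> n)) + r\<^sup>2"
          unfolding power2_norm_eq_inner using n by (simp add: inner_diff norm_eq_1 inner_commute algebra_simps power2_eq_square)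
        also have "\<dots> < r\<^sup>2" using elim by (simp add: mult_pos_neg)
        finally have "norm (h *\<^sub>R v - r *\<^sub>R n) < r" using r by (simp add: power_less_imp_less_base)
        then have "q + h *\<^sub>R v \<in> ball (q + r *\<^sub>R n) r" by (simp add: dist_norm norm_minus_commute)
        then have "\<phi> (q + h *\<^sub>R v) < 0" using inside \<Omega> elim by blast
        then show False using d(2)[of h] elim phiq by simp
    qed
    then show ?thesis by simp
  qed
  have perp: "l v = 0" if v: "v \<bullet> n = 0" for v
  proof (rule ccontr)
    assume nz: "l v \<noteq> 0"
    have nn: "n \<bullet> n = 1" using n by (simp add: norm_eq_1)
    \<comment> \<open>with this multiple, \<open>l\<close> takes the value 1 at a vector with positive normal component\<close>
    define k where "k = (1 - l n) / l v"
    have "l (k *\<^sub>R v + n) \<le> 0" by (rule le1) (simp add: inner_left_distrib v nn)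
    then show False using nz by (simp add: linear_add[OF lin] linear_cmul[OF lin] k_def)
  qed
  have l: "l v = (v \<bullet> n) * l n" for v
  proof -
    have "l (v - (v \<bullet> n) *\<^sub>R n) = 0" using n by (intro perp) (simp add: inner_diff_left norm_eq_1)
    then have "l v - (v \<bullet> n) *\<^sub>R l n = 0" by (simp only: linear_diff[OF lin] linear_cmul[OF lin])
    then show ?thesis by simp
  qed
  define g where "g = - l n"
  have "l n \<le> 0" using n by (intro le1) (simp add: norm_eq_1)
  moreover have "l n \<noteq> 0"
  proof
    assume "l n = 0"
    then have "l v = 0" for v using l[of v] by simp
    then show False using nz by (auto simp: l_def)
  qed
  ultimately have g: "g > 0" by (simp add: g_def)
  obtain C \<delta> where C: "C \<ge> 0" "\<delta> > 0" "ball q \<delta> \<subseteq> U"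
    "\<And>y. y \<in> ball q \<delta> \<Longrightarrow> \<phi> q + l (y - q) - C * (norm (y - q))\<^sup>2 \<le> \<phi> y"
    using quadratic_lower_bound[OF U C2] unfolding l_def by blast
  define s0 where "s0 = min (\<delta> / 2) (g / (2 * (C + 1)))"
  have "s0 > 0" using C g by (simp add: s0_def)
  moreover have "ball (q - s *\<^sub>R n) s \<inter> closure \<Omega> = {}" if s: "0 < s" "s \<le> s0" for s
  proof -
    have "y \<notin> \<Omega>" if y: "y \<in> ball (q - s *\<^sub>R n) s" for y
    proof -
      define h where "h = y - q"
      have hs: "norm (h + s *\<^sub>R n) < s" using y by (simp add: h_def dist_norm norm_minus_commute algebra_simps)
      have "norm h \<le> norm (h + s *\<^sub>R n) + norm (s *\<^sub>R n)"
        using norm_triangle_ineq4[of "h + s *\<^sub>R n" "s *\<^sub>R n"] by simp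
      then have "norm h < \<delta>" using hs s n by (simp add: s0_def)
      then have yb: "y \<in> ball q \<delta>" by (simp add: h_def dist_norm norm_minus_commute)
      have "(norm (h + s *\<^sub>R n))\<^sup>2 < s\<^sup>2" using hs by (simp add: power_strict_mono)
      moreover have "(norm (h + s *\<^sub>R n))\<^sup>2 = (norm h)\<^sup>2 + 2 * s * (h \<bullet> n) + s\<^sup>2"
        unfolding power2_norm_eq_inner using n by (simp add: inner_add norm_eq_1 inner_commute algebra_simps power2_eq_square)
      ultimately have hn: "(norm h)\<^sup>2 < 2 * s * (- (h \<bullet> n))" by simp
      then have "0 < 2 * s * (- (h \<bullet> n))" by (rule le_less_trans[OF zero_le_power2])
      then have "- (h \<bullet> n) > 0" using s(1) by (simp add: zero_less_mult_iff mult_less_0_iff)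
      have "s \<le> g / (2 * (C + 1))" using s by (simp add: s0_def)
      then have "s * (2 * (C + 1)) \<le> g" using C(1) by (subst (asm) pos_le_divide_eq) auto
      then have "2 * s * C \<le> g" using s(1) by (simp add: algebra_simps)
      then have "2 * s * C * (- (h \<bullet> n)) \<le> g * (- (h \<bullet> n))"
        using \<open>- (h \<bullet> n) > 0\<close> by (intro mult_right_mono) auto
      moreover have "C * (norm h)\<^sup>2 \<le> C * (2 * s * (- (h \<bullet> n)))"
        using hn C(1) by (intro mult_left_mono) auto
      ultimately have "C * (norm h)\<^sup>2 \<le> l h"
        using l[of h] by (simp add: g_def mult_ac)
      then have "\<phi> y \<ge> 0" using C(4)[OF yb] phiq by (simp add: h_def)
      then show ?thesis using \<Omega> yb C(3) by force
    qed
    then have "ball (q - s *\<^sub>R n) s \<inter> \<Omega> = {}" by blast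
    then show ?thesis by (simp add: open_Int_closure_eq_empty)
  qed
  ultimately show ?thesis by blast
qed

lemma connected_in_or_out:
  assumes "connected S" "S \<inter> frontier T = {}"
  shows "S \<subseteq> T \<or> S \<inter> T = {}"
  using connected_Int_frontier[OF assms(1), of T] assms(2) by blast

text \<open>Each of the two sides starts from some tangent ball disjoint from the boundary, which is then
  enlarged along the normal. A ball that misses the boundary is connected, so it lies on one side
  of it, the one of the ball from which it was obtained.\<close>

lemma tangent_balls:
  fixes \<Omega> :: "'a::euclidean_space set"
  assumes \<Omega>: "open \<Omega>" "bounded \<Omega>" "C3_boundary \<Omega>"
    and uniq: "unique_projection (frontier \<Omega>) L"
    and q: "q \<in> frontier \<Omega>" and n: "norm n = 1" and r: "0 < r" "r < L"
    and inside: "ball (q + r *\<^sub>R n) r \<subseteq> \<Omega>"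
    and s: "0 < s" "s < L"
  shows "ball (q + s *\<^sub>R n) s \<subseteq> \<Omega>" and "ball (q - s *\<^sub>R n) s \<inter> \<Omega> = {}"
proof -
  have comp: "compact (frontier \<Omega>)" using \<Omega> by (simp add: compact_frontier_bounded)
  have near: "q + \<epsilon> *\<^sub>R m \<in> ball (q + t *\<^sub>R m) t" if "norm m = 1" "0 < \<epsilon>" "\<epsilon> \<le> t" for \<epsilon> t m
    using that by (simp add: dist_norm flip: scaleR_left_diff_distrib)
  have "\<Omega> \<inter> frontier \<Omega> = {}" using \<Omega>(1) frontier_disjoint_eq by blast
  then have "ball (q + r *\<^sub>R n) r \<inter> frontier \<Omega> = {}" using inside by blast
  then have "ball (q + s *\<^sub>R n) s \<inter> frontier \<Omega> = {}"
    by (intro normal_ball_extends[OF comp uniq q n r _ s(2)])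
  moreover have "q + min r s *\<^sub>R n \<in> ball (q + s *\<^sub>R n) s \<inter> \<Omega>"
    using near[OF n, of "min r s" r] near[OF n, of "min r s" s] inside r s by auto
  ultimately show "ball (q + s *\<^sub>R n) s \<subseteq> \<Omega>"
    using connected_in_or_out[OF connected_ball] by blast
  obtain s0 where s0: "s0 > 0" "\<And>s. 0 < s \<Longrightarrow> s \<le> s0 \<Longrightarrow> ball (q - s *\<^sub>R n) s \<inter> closure \<Omega> = {}"
    using exterior_ball[OF \<Omega>(1,3) q n r(1) inside] by blast
  define t where "t = min s0 s"
  have t: "0 < t" "t \<le> s0" "t \<le> s" "t < L" using s0 s by (auto simp: t_def)
  have n': "norm (- n) = 1" using n by simp
  have out: "ball (q + t *\<^sub>R (- n)) t \<inter> closure \<Omega> = {}" using s0(2)[OF t(1,2)] by simp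
  then have "ball (q + t *\<^sub>R (- n)) t \<inter> frontier \<Omega> = {}" by (auto simp: frontier_def)
  then have "ball (q + s *\<^sub>R (- n)) s \<inter> frontier \<Omega> = {}"
    by (intro normal_ball_extends[OF comp uniq q n' t(1,4) _ s(2)])
  moreover have "q + t *\<^sub>R (- n) \<in> ball (q + s *\<^sub>R (- n)) s - \<Omega>"
    using near[OF n' t(1), of t] near[OF n' t(1), of s] out t closure_subset[of \<Omega>] by fastforce
  ultimately show "ball (q - s *\<^sub>R n) s \<inter> \<Omega> = {}"
    using connected_in_or_out[OF connected_ball] by fastforce
qed

section \<open>The normal as a Lipschitz function\<close>

lemma dist_centers_of_disjoint_balls:
  fixes x y :: "'a::euclidean_space"
  assumes "ball x s \<inter> ball y s = {}" "s > 0"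
  shows "2 * s \<le> dist x y"
proof (rule ccontr)
  assume "\<not> 2 * s \<le> dist x y"
  then have "midpoint x y \<in> ball x s \<inter> ball y s" by (simp add: dist_midpoint)
  then show False using assms(1) by blast
qed

text \<open>The centers of the inner ball at one point and the outer ball at the other are at distance at least
  \<open>2 s\<close>. Adding the squares of the two such inequalities, the parallelogram identity cancels the
  mixed terms.\<close>

lemma normals_lipschitz:
  fixes q q' n n' :: "'a::euclidean_space"
  assumes n: "norm n = 1" "norm n' = 1" and s: "s > 0"
    and disj: "ball (q + s *\<^sub>R n) s \<inter> ball (q' - s *\<^sub>R n') s = {}"
      "ball (q' + s *\<^sub>R n') s \<inter> ball (q - s *\<^sub>R n) s = {}"
  shows "s * norm (n - n') \<le> norm (q - q')"
proof -
  define h where "h = q - q'"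
  have a: "(2 * s)\<^sup>2 \<le> (norm (h + s *\<^sub>R (n + n')))\<^sup>2"
    using dist_centers_of_disjoint_balls[OF disj(1) s] s
    by (intro power_mono) (auto simp: dist_norm h_def algebra_simps)
  have b: "(2 * s)\<^sup>2 \<le> (norm (h - s *\<^sub>R (n + n')))\<^sup>2"
    using dist_centers_of_disjoint_balls[OF disj(2) s] s
    by (intro power_mono) (auto simp: dist_norm norm_minus_commute h_def algebra_simps)
  have nn: "n \<bullet> n = 1" "n' \<bullet> n' = 1" using n by (simp_all add: norm_eq_1)
  have "(norm (h + s *\<^sub>R (n + n')))\<^sup>2 + (norm (h - s *\<^sub>R (n + n')))\<^sup>2 + 2 * s\<^sup>2 * (norm (n - n'))\<^sup>2
      = 2 * (norm h)\<^sup>2 + 8 * s\<^sup>2"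
    unfolding power2_norm_eq_inner using nn
    by (simp add: inner_add inner_diff inner_commute algebra_simps power2_eq_square)
  with a b have "(s * norm (n - n'))\<^sup>2 \<le> (norm h)\<^sup>2" by (simp add: power_mult_distrib)
  then show ?thesis unfolding h_def by (rule power2_le_imp_le) simp
qed

text \<open>The tangent ball in coordinates centered at the contact point. The sign of \<open>c\<close> selects the side.\<close>

lemma mem_tangent_ball:
  fixes n h :: "'a::real_inner"
  assumes n: "norm n = 1" and s: "s > 0"
    and "(norm h)\<^sup>2 < 2 * c * (h \<bullet> n)" "c\<^sup>2 = s\<^sup>2"
  shows "q + h \<in> ball (q + c *\<^sub>R n) s"
proof -
  have nn: "n \<bullet> n = 1" using n by (simp add: norm_eq_1)
  have "(norm (h - c *\<^sub>R n))\<^sup>2 = (norm h)\<^sup>2 - 2 * c * (h \<bullet> n) + c\<^sup>2"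
    unfolding power2_norm_eq_inner using nn
    by (simp add: inner_diff inner_commute algebra_simps power2_eq_square)
  then have "(norm (h - c *\<^sub>R n))\<^sup>2 < s\<^sup>2" using assms by simp
  then have "norm (h - c *\<^sub>R n) < s" using s by (simp add: power_less_imp_less_base)
  then show ?thesis by (simp add: dist_norm norm_minus_commute)
qed

text \<open>At a boundary point touched by balls from both sides, the tangent space is exactly the hyperplane
  orthogonal to the common axis of the balls.\<close>

context
  fixes \<Omega> :: "'a::euclidean_space set" and q n :: 'a and s :: real
  assumes \<Omega>: "open \<Omega>" and n: "norm n = 1" and s: "s > 0" and q: "q \<in> frontier \<Omega>"
    and inn: "ball (q + s *\<^sub>R n) s \<subseteq> \<Omega>" and out: "ball (q - s *\<^sub>R n) s \<inter> \<Omega> = {}"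
begin

text \<open>The boundary avoids both balls, so it deviates at most quadratically from the hyperplane.\<close>

lemma frontier_between_tangent_balls:
  assumes "q + h \<in> frontier \<Omega>"
  shows "2 * s * \<bar>h \<bullet> n\<bar> \<le> (norm h)\<^sup>2"
proof -
  have clout: "ball (q - s *\<^sub>R n) s \<inter> closure \<Omega> = {}"
    using out by (simp add: open_Int_closure_eq_empty)
  have "\<Omega> \<inter> frontier \<Omega> = {}" using \<Omega> frontier_disjoint_eq by blast
  then have "\<not> (norm h)\<^sup>2 < 2 * s * (h \<bullet> n)"
    using mem_tangent_ball[OF n s, of h s q] assms inn by blast
  moreover have "\<not> (norm h)\<^sup>2 < 2 * (- s) * (h \<bullet> n)"
    using mem_tangent_ball[OF n s, of h "- s" q] assms clout by (auto simp: frontier_def)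
  ultimately show ?thesis by (simp add: abs_if)
qed

text \<open>A difference quotient of a curve in the boundary has a normal component of order \<open>t\<close>, by the
  quadratic bound.\<close>

lemma tangent_space_orthogonal_normal:
  assumes \<tau>: "\<tau> \<in> tangent_space (frontier \<Omega>) q"
  shows "n \<bullet> \<tau> = 0"
proof -
  obtain c \<epsilon> where c: "\<epsilon> > 0" "\<And>t. t \<in> {-\<epsilon><..<\<epsilon>} \<Longrightarrow> c t \<in> frontier \<Omega>" "c 0 = q"
    "(c has_vector_derivative \<tau>) (at 0)"
    using \<tau> unfolding tangent_space_def by blast
  have lim0: "((\<lambda>t. norm ((c t - q) - t *\<^sub>R \<tau>) / norm t) \<longlongrightarrow> 0) (at 0)"
    using c(3,4) by (simp add: has_vector_derivative_def has_derivative_iff_norm)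
  have eq: "norm ((c t - q) - t *\<^sub>R \<tau>) / norm t = norm ((c t - q) /\<^sub>R t - \<tau>)" if "t \<noteq> 0" for t
  proof -
    have "(c t - q) - t *\<^sub>R \<tau> = t *\<^sub>R ((c t - q) /\<^sub>R t - \<tau>)" using that by (simp add: scaleR_diff_right)
    then show ?thesis using that by simp
  qed
  from lim0 have "((\<lambda>t. norm ((c t - q) /\<^sub>R t - \<tau>)) \<longlongrightarrow> 0) (at 0)"
    by (rule Lim_transform_eventually) (use eq in \<open>auto simp: eventually_at intro!: exI[of _ 1]\<close>)
  then have "((\<lambda>t. (c t - q) /\<^sub>R t - \<tau>) \<longlongrightarrow> 0) (at 0)"
    by (rule tendsto_norm_zero_cancel)
  then have lim: "((\<lambda>t. (c t - q) /\<^sub>R t) \<longlongrightarrow> \<tau>) (at 0)"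
    by (rule LIM_zero_cancel)
  then have "((\<lambda>t. 2 * s * \<bar>((c t - q) /\<^sub>R t) \<bullet> n\<bar>) \<longlongrightarrow> 2 * s * \<bar>\<tau> \<bullet> n\<bar>) (at 0)"
    by (intro tendsto_intros)
  moreover have "((\<lambda>t. \<bar>t\<bar> * (norm ((c t - q) /\<^sub>R t))\<^sup>2) \<longlongrightarrow> \<bar>0\<bar> * (norm \<tau>)\<^sup>2) (at 0)"
    using lim by (intro tendsto_intros)
  moreover have "\<forall>\<^sub>F t in at 0. 2 * s * \<bar>((c t - q) /\<^sub>R t) \<bullet> n\<bar> \<le> \<bar>t\<bar> * (norm ((c t - q) /\<^sub>R t))\<^sup>2"
  proof -
    have "2 * s * \<bar>((c t - q) /\<^sub>R t) \<bullet> n\<bar> \<le> \<bar>t\<bar> * (norm ((c t - q) /\<^sub>R t))\<^sup>2"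
      if t: "t \<noteq> 0" "\<bar>t\<bar> < \<epsilon>" for t
    proof -
      define w where "w = (c t - q) /\<^sub>R t"
      have w: "c t - q = t *\<^sub>R w" using t by (simp add: w_def)
      have "2 * s * \<bar>(c t - q) \<bullet> n\<bar> \<le> (norm (c t - q))\<^sup>2"
        using c(2)[of t] t by (intro frontier_between_tangent_balls) (auto simp: abs_less_iff)
      then have "\<bar>t\<bar> * (2 * s * \<bar>w \<bullet> n\<bar>) \<le> \<bar>t\<bar> * (\<bar>t\<bar> * (norm w)\<^sup>2)"
        unfolding w by (simp add: abs_mult power2_eq_square mult_ac)
      then show ?thesis using t(1) unfolding w_def[symmetric] by (subst (asm) mult_le_cancel_left_pos) auto
    qed
    then show ?thesis using c(1) by (auto simp: eventually_at intro!: exI[of _ \<epsilon>])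
  qed
  ultimately have "2 * s * \<bar>\<tau> \<bullet> n\<bar> \<le> \<bar>0\<bar> * (norm \<tau>)\<^sup>2"
    by (intro tendsto_le[OF trivial_limit_at]) auto
  then show ?thesis using s by (simp add: inner_commute mult_le_0_iff)
qed

text \<open>Over the point \<open>q + t *\<^sub>R \<tau>\<close> of the hyperplane, the normal segment of half-length \<open>C * t\<^sup>2\<close> joins
  the inner to the outer ball and therefore meets the boundary. Any choice of such meeting points is
  a curve that is differentiable at \<open>0\<close>, although possibly not continuous elsewhere, with
  derivative \<open>\<tau>\<close>.\<close>

lemma orthogonal_normal_in_tangent_space:
  assumes perp: "\<tau> \<bullet> n = 0"
  shows "\<tau> \<in> tangent_space (frontier \<Omega>) q"
proof -
  have nn: "n \<bullet> n = 1" using n by (simp add: norm_eq_1)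
  \<comment> \<open>Any \<open>C\<close> with \<open>C * s > |\<tau>|\<^sup>2 / 2\<close> reaches into the balls for small \<open>t\<close>;
     the summand 1 leaves room for the term of order \<open>t\<^sup>4\<close>.\<close>
  define C where "C = ((norm \<tau>)\<^sup>2 + 1) / s"
  have C: "C > 0" "C * s = (norm \<tau>)\<^sup>2 + 1" using s by (auto simp: C_def add_nonneg_pos)
  define \<epsilon> where "\<epsilon> = 1 / C"
  have "\<epsilon> > 0" using C by (simp add: \<epsilon>_def)
  have ex: "\<exists>y. \<bar>y\<bar> \<le> C * t\<^sup>2 \<and> q + t *\<^sub>R \<tau> + y *\<^sub>R n \<in> frontier \<Omega>" if t: "\<bar>t\<bar> < \<epsilon>" for t
  proof (cases "t = 0")
    case True
    then show ?thesis using q by (intro exI[of _ 0]) auto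
  next
    case False
    have "C * \<bar>t\<bar> < 1" using t C by (simp add: \<epsilon>_def field_simps)
    then have "(C * \<bar>t\<bar>)\<^sup>2 < 1" using C by (simp add: abs_square_less_1 abs_mult)
    then have Ct: "C\<^sup>2 * t\<^sup>2 < 1" by (simp add: power_mult_distrib)
    define h where "h y = t *\<^sub>R \<tau> + y *\<^sub>R n" for y
    have hn: "h y \<bullet> n = y" "(norm (h y))\<^sup>2 = t\<^sup>2 * (norm \<tau>)\<^sup>2 + y\<^sup>2" for y
      unfolding power2_norm_eq_inner h_def using nn perp
      by (simp_all add: inner_add inner_commute algebra_simps power2_eq_square)
    have "t\<^sup>2 * (norm \<tau>)\<^sup>2 + (C * t\<^sup>2)\<^sup>2 < 2 * s * (C * t\<^sup>2)"
    proof -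
      have "t\<^sup>2 * (norm \<tau>)\<^sup>2 + (C * t\<^sup>2)\<^sup>2 = t\<^sup>2 * ((norm \<tau>)\<^sup>2 + C\<^sup>2 * t\<^sup>2)"
        by (simp add: power2_eq_square algebra_simps)
      also have "\<dots> < t\<^sup>2 * (2 * (C * s))"
        using Ct False C(2) zero_le_power2[of "norm \<tau>"]
        by (intro mult_strict_left_mono) (linarith, simp)
      finally show ?thesis by (simp add: mult_ac)
    qed
    then have "q + h (C * t\<^sup>2) \<in> ball (q + s *\<^sub>R n) s" "q + h (- (C * t\<^sup>2)) \<in> ball (q + (- s) *\<^sub>R n) s"
      by (intro mem_tangent_ball[OF n s]; simp add: hn)+
    then have "q + h (C * t\<^sup>2) \<in> \<Omega>" "q + h (- (C * t\<^sup>2)) \<notin> \<Omega>" using inn out by auto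
    moreover have "connected ((\<lambda>y. q + h y) ` {- (C * t\<^sup>2)..C * t\<^sup>2})"
      unfolding h_def by (intro connected_continuous_image continuous_intros) auto
    moreover have "0 \<le> C * t\<^sup>2" using C by simp
    moreover from this have "q + h (C * t\<^sup>2) \<in> (\<lambda>y. q + h y) ` {- (C * t\<^sup>2)..C * t\<^sup>2}"
      "q + h (- (C * t\<^sup>2)) \<in> (\<lambda>y. q + h y) ` {- (C * t\<^sup>2)..C * t\<^sup>2}" by auto
    ultimately have "(\<lambda>y. q + h y) ` {- (C * t\<^sup>2)..C * t\<^sup>2} \<inter> frontier \<Omega> \<noteq> {}"
      by (intro connected_Int_frontier) blast+
    then obtain z where "z \<in> {- (C * t\<^sup>2)..C * t\<^sup>2}" "q + h z \<in> frontier \<Omega>" by blast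
    then show ?thesis by (intro exI[of _ z]) (auto simp: h_def add.assoc)
  qed
  then obtain y where y: "\<And>t. \<bar>t\<bar> < \<epsilon> \<Longrightarrow> \<bar>y t\<bar> \<le> C * t\<^sup>2 \<and> q + t *\<^sub>R \<tau> + y t *\<^sub>R n \<in> frontier \<Omega>"
    by metis
  define c where "c t = q + t *\<^sub>R \<tau> + y t *\<^sub>R n" for t
  have "y 0 = 0" using y[of 0] \<open>\<epsilon> > 0\<close> by simp
  have y': "(y has_real_derivative 0) (at 0)"
  proof -
    have lim: "((\<lambda>t. C * \<bar>t\<bar>) \<longlongrightarrow> C * \<bar>0\<bar>) (at 0)" by (intro tendsto_intros)
    have "\<bar>y t / t\<bar> \<le> C * \<bar>t\<bar>" if "t \<noteq> 0" "\<bar>t\<bar> < \<epsilon>" for t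
    proof -
      have "\<bar>y t\<bar> \<le> (C * \<bar>t\<bar>) * \<bar>t\<bar>" using y[OF that(2)] by (simp add: power2_eq_square mult_ac)
      then show ?thesis using that(1) by (simp add: abs_divide pos_divide_le_eq)
    qed
    then have ev: "\<forall>\<^sub>F t in at 0. norm (y t / t) \<le> C * \<bar>t\<bar>"
      using \<open>\<epsilon> > 0\<close> by (auto simp: eventually_at intro!: exI[of _ \<epsilon>])
    have "((\<lambda>t. y t / t) \<longlongrightarrow> 0) (at 0)"
      using Lim_null_comparison[OF ev] lim by simp
    then show ?thesis using \<open>y 0 = 0\<close> by (simp add: DERIV_def)
  qed
  have "(y has_derivative (\<lambda>_. 0)) (at 0)"
    by (rule has_derivative_eq_rhs[OF y'[unfolded has_field_derivative_def]]) auto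
  then have "(c has_vector_derivative \<tau>) (at 0)"
    unfolding has_vector_derivative_def c_def by (auto intro!: derivative_eq_intros)
  moreover have "c 0 = q" by (simp add: c_def \<open>y 0 = 0\<close>)
  moreover have "c t \<in> frontier \<Omega>" if "t \<in> {-\<epsilon><..<\<epsilon>}" for t
    using y[of t] that by (auto simp: c_def abs_less_iff)
  ultimately show ?thesis using \<open>\<epsilon> > 0\<close> unfolding tangent_space_def by blast
qed

text \<open>A unit vector orthogonal to the tangent space is \<open>n\<close> or \<open>- n\<close>, and the inner ball excludes \<open>n\<close>.\<close>

lemma outer_normal_eq: "outer_normal \<Omega> q = - n"
proof -
  have nn: "n \<bullet> n = 1" using n by (simp add: norm_eq_1)
  have clout: "ball (q - s *\<^sub>R n) s \<inter> closure \<Omega> = {}"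
    using out by (simp add: open_Int_closure_eq_empty)
  have along: "q + t *\<^sub>R m \<in> ball (q + s *\<^sub>R m) s" if "norm m = 1" "0 < t" "t < s" for m t
    using that by (simp add: dist_norm flip: scaleR_left_diff_distrib)
  show ?thesis unfolding outer_normal_def
  proof (rule the_equality, intro conjI ballI)
    have "q + t *\<^sub>R (- n) \<notin> closure \<Omega>" if "0 < t" "t < s" for t
      using along[of "- n" t] n that clout by auto
    then show "\<forall>\<^sub>F t in at_right 0. q + t *\<^sub>R (- n) \<notin> closure \<Omega>"
      by (intro eventually_at_rightI[of 0 s]) (use s in auto)
  next
    fix m assume m: "norm m = 1 \<and> (\<forall>\<tau>\<in>tangent_space (frontier \<Omega>) q. m \<bullet> \<tau> = 0) \<and>
      (\<forall>\<^sub>F t in at_right 0. q + t *\<^sub>R m \<notin> closure \<Omega>)"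
    define \<tau> where "\<tau> = m - (m \<bullet> n) *\<^sub>R n"
    have "\<tau> \<bullet> n = 0" by (simp add: \<tau>_def inner_diff_left nn)
    then have "m \<bullet> \<tau> = 0" using m orthogonal_normal_in_tangent_space by blast
    then have "\<tau> \<bullet> \<tau> = 0" using \<open>\<tau> \<bullet> n = 0\<close>
      by (metis \<tau>_def diff_zero inner_commute inner_diff_left inner_scaleR_left mult_zero_right)
    then have mn: "m = (m \<bullet> n) *\<^sub>R n" by (simp add: \<tau>_def)
    then have "\<bar>m \<bullet> n\<bar> = 1" using m n by (metis mult_cancel_left1 norm_scaleR mult.right_neutral)
    moreover have "m \<noteq> n"
    proof
      assume "m = n"
      have "q + t *\<^sub>R n \<in> closure \<Omega>" if "0 < t" "t < s" for t
        using along[OF n that] inn closure_subset by blast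
      then have "\<forall>\<^sub>F t in at_right 0. q + t *\<^sub>R n \<in> closure \<Omega>"
        by (intro eventually_at_rightI[of 0 s]) (use s in auto)
      moreover have "\<forall>\<^sub>F t in at_right 0. q + t *\<^sub>R n \<notin> closure \<Omega>"
        using m \<open>m = n\<close> by simp
      ultimately have "\<forall>\<^sub>F t in at_right (0::real). False"
        by (rule eventually_elim2) simp
      then show False by simp
    qed
    ultimately have "m \<bullet> n = - 1" using mn by (auto simp: abs_if split: if_splits)
    then show "m = - n" using mn by simp
  qed (use n tangent_space_orthogonal_normal in auto)
qed

end

text \<open>The greatest admissible radius exists. The condition is inherited by suprema, and the radii are
  bounded: a nearest boundary point of some interior point is touched by balls in \<open>\<Omega>\<close> of every
  admissible radius, and \<open>\<Omega>\<close> is bounded.\<close>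

lemma unique_projection_reach:
  fixes \<Omega> :: "'a::euclidean_space set"
  assumes \<Omega>: "open \<Omega>" "bounded \<Omega>" "\<Omega> \<noteq> {}"
  shows "unique_projection (frontier \<Omega>) (reach (frontier \<Omega>))"
proof -
  let ?P = "unique_projection (frontier \<Omega>)"
  have comp: "compact (frontier \<Omega>)" using \<Omega> by (simp add: compact_frontier_bounded)
  have "\<Omega> \<noteq> UNIV" using \<Omega>(2) by (metis not_bounded_UNIV)
  then have ne: "frontier \<Omega> \<noteq> {}" using \<Omega>(3) by (simp add: frontier_not_empty)
  have disj: "\<Omega> \<inter> frontier \<Omega> = {}" using \<Omega>(1) frontier_disjoint_eq by blast
  obtain x0 where x0: "x0 \<in> \<Omega>" using \<Omega>(3) by blast
  obtain q where q: "q \<in> frontier \<Omega>" "infdist x0 (frontier \<Omega>) = dist x0 q"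
    using infdist_attains_inf[OF _ ne] comp compact_imp_closed by blast
  define r where "r = dist x0 q"
  have r: "r > 0" using q(1) x0 disj by (auto simp: r_def)
  define n where "n = (x0 - q) /\<^sub>R r"
  have n: "norm n = 1" using r by (simp add: n_def r_def dist_norm)
  have x0n: "q + r *\<^sub>R n = x0" using r by (simp add: n_def)
  have avoid: "ball (q + r *\<^sub>R n) r \<inter> frontier \<Omega> = {}"
    unfolding x0n using infdist_le[of _ "frontier \<Omega>" x0] q(2) by (force simp: r_def)
  have "L \<le> max r (diameter \<Omega>)" if "?P L" for L
  proof (rule ccontr)
    assume "\<not> L \<le> max r (diameter \<Omega>)"
    then have L: "r < L" "diameter \<Omega> < L" by auto
    define s where "s = max r (diameter \<Omega>)"
    have s: "r \<le> s" "diameter \<Omega> \<le> s" "s < L" using L by (auto simp: s_def)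
    have "ball (q + s *\<^sub>R n) s \<inter> frontier \<Omega> = {}"
      by (rule normal_ball_extends[OF comp that q(1) n r L(1) avoid s(3)])
    moreover have in1: "q + r *\<^sub>R n \<in> ball (q + s *\<^sub>R n) s"
      using n r s by (simp add: dist_norm flip: scaleR_left_diff_distrib)
    ultimately have sub: "ball (q + s *\<^sub>R n) s \<subseteq> \<Omega>"
      using connected_in_or_out[OF connected_ball, of "q + s *\<^sub>R n" s \<Omega>] x0 unfolding x0n by blast
    have "diameter (ball (q + s *\<^sub>R n) s) = 2 * s" using r s by (simp add: diameter_ball)
    then have "2 * s \<le> diameter \<Omega>" using diameter_subset[OF sub \<Omega>(2)] by simp
    then show False using r s by simp
  qed
  then have bdd: "bdd_above {L. ?P L}" by (intro bdd_aboveI[of _ "max r (diameter \<Omega>)"]) (simp only: mem_Collect_eq)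
  have "?P 0" by (simp add: unique_projection_def leD[OF infdist_nonneg])
  then have "?P (Sup {L. ?P L})"
    unfolding unique_projection_def[of _ "Sup _"]
    using less_cSup_iff[OF _ bdd] by (fastforce simp: unique_projection_def)
  moreover have "L \<le> Sup {L. ?P L}" if "?P L" for L using bdd that by (simp add: cSup_upper)
  ultimately have "Greatest ?P = Sup {L. ?P L}" by (intro Greatest_equality)
  then show ?thesis using \<open>?P (Sup _)\<close>
    by (simp add: reach_def unique_projection_def[abs_def])
qed

section \<open>An inward vector field defined in the whole space\<close>

text \<open>McShane's formula: the lower envelope of the cones of slope \<open>C\<close> over the graph of \<open>f\<close>, truncated
  to keep the bound.\<close>

lemma bounded_lipschitz_extension:
  fixes f :: "'a::metric_space \<Rightarrow> real" and B C :: real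
  assumes bound: "\<And>x. x \<in> A \<Longrightarrow> \<bar>f x\<bar> \<le> B"
    and lip: "\<And>x y. \<lbrakk>x \<in> A; y \<in> A\<rbrakk> \<Longrightarrow> \<bar>f x - f y\<bar> \<le> C * dist x y"
    and "B \<ge> 0" "C \<ge> 0"
  shows "\<exists>g. (\<forall>x\<in>A. g x = f x) \<and> (\<forall>x. \<bar>g x\<bar> \<le> B) \<and> (\<forall>x y. \<bar>g x - g y\<bar> \<le> C * dist x y)"
proof (cases "A = {}")
  case True
  then show ?thesis using assms by (intro exI[of _ "\<lambda>_. 0"]) auto
next
  case False
  define h where "h x = (INF a\<in>A. f a + C * dist x a)" for x
  have bdd: "bdd_below ((\<lambda>a. f a + C * dist x a) ` A)" for x
  proof (rule bdd_belowI2)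
    fix a assume "a \<in> A"
    then show "- B \<le> f a + C * dist x a"
      using bound[of a] mult_nonneg_nonneg[OF \<open>C \<ge> 0\<close>, of "dist x a"] by (simp add: abs_le_iff)
  qed
  have eq: "h x = f x" if "x \<in> A" for x
  proof (rule antisym)
    show "h x \<le> f x" unfolding h_def using cINF_lower[OF bdd that, of x] by simp
    show "f x \<le> h x" unfolding h_def
    proof (rule cINF_greatest[OF False])
      fix a assume "a \<in> A"
      then show "f x \<le> f a + C * dist x a" using lip[OF that, of a] by (simp add: abs_le_iff)
    qed
  qed
  have le: "h x \<le> h y + C * dist x y" for x y
  proof -
    have "h x - C * dist x y \<le> (INF a\<in>A. f a + C * dist y a)"
    proof (rule cINF_greatest[OF False])
      fix a assume "a \<in> A"
      have "h x \<le> f a + C * dist x a" unfolding h_def by (rule cINF_lower[OF bdd \<open>a \<in> A\<close>])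
      also have "\<dots> \<le> f a + C * (dist x y + dist y a)"
        using \<open>C \<ge> 0\<close> by (intro add_left_mono mult_left_mono dist_triangle)
      finally show "h x - C * dist x y \<le> f a + C * dist y a" by (simp add: algebra_simps)
    qed
    then show ?thesis by (simp add: h_def)
  qed
  define g where "g x = max (- B) (min B (h x))" for x
  have "g x = f x" if "x \<in> A" for x
    using eq[OF that] bound[OF that] by (auto simp: g_def max_def min_def abs_le_iff)
  moreover have "\<bar>g x\<bar> \<le> B" for x using \<open>B \<ge> 0\<close> by (auto simp: g_def)
  moreover have "\<bar>g x - g y\<bar> \<le> C * dist x y" for x y
  proof -
    have "\<bar>g x - g y\<bar> \<le> \<bar>h x - h y\<bar>" by (auto simp: g_def)
    also have "\<dots> \<le> C * dist x y" using le[of x y] le[of y x] by (simp add: abs_le_iff dist_commute)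
    finally show ?thesis .
  qed
  ultimately show ?thesis by blast
qed

lemma bounded_lipschitz_extension_euclidean:
  fixes f :: "'a::metric_space \<Rightarrow> 'b::euclidean_space" and B C :: real
  assumes bound: "\<And>x. x \<in> A \<Longrightarrow> norm (f x) \<le> B"
    and lip: "\<And>x y. \<lbrakk>x \<in> A; y \<in> A\<rbrakk> \<Longrightarrow> norm (f x - f y) \<le> C * dist x y"
    and "B \<ge> 0" "C \<ge> 0"
  shows "\<exists>g. (\<forall>x\<in>A. g x = f x) \<and> (\<forall>x. norm (g x) \<le> DIM('b) * B) \<and>
             (\<forall>x y. norm (g x - g y) \<le> DIM('b) * C * dist x y)"
proof -
  have "\<exists>g. (\<forall>x\<in>A. g x = f x \<bullet> b) \<and> (\<forall>x. \<bar>g x\<bar> \<le> B) \<and> (\<forall>x y. \<bar>g x - g y\<bar> \<le> C * dist x y)"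
    if "b \<in> Basis" for b
  proof (rule bounded_lipschitz_extension)
    fix x y assume "x \<in> A" "y \<in> A"
    show "\<bar>f x \<bullet> b\<bar> \<le> B" using Basis_le_norm[OF that] bound[OF \<open>x \<in> A\<close>] order_trans by blast
    show "\<bar>f x \<bullet> b - f y \<bullet> b\<bar> \<le> C * dist x y"
      using Basis_le_norm[OF that, of "f x - f y"] lip[OF \<open>x \<in> A\<close> \<open>y \<in> A\<close>]
      by (simp add: inner_diff_left)
  qed (use assms in auto)
  then obtain g where g: "\<And>b x. \<lbrakk>b \<in> Basis; x \<in> A\<rbrakk> \<Longrightarrow> g b x = f x \<bullet> b"
    "\<And>b x. b \<in> Basis \<Longrightarrow> \<bar>g b x\<bar> \<le> B" "\<And>b x y. b \<in> Basis \<Longrightarrow> \<bar>g b x - g b y\<bar> \<le> C * dist x y"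
    by metis
  define G where "G x = (\<Sum>b\<in>Basis. g b x *\<^sub>R b)" for x
  have Gb: "G x \<bullet> b = g b x" if "b \<in> Basis" for x b
    using that by (simp add: G_def)
  have "G x = f x" if "x \<in> A" for x
    by (rule euclidean_eqI) (simp add: Gb g(1) that)
  moreover have "norm (G x) \<le> DIM('b) * B" for x
  proof -
    have "norm (G x) \<le> (\<Sum>b\<in>Basis. \<bar>G x \<bullet> b\<bar>)" by (rule norm_le_l1)
    also have "\<dots> \<le> (\<Sum>b\<in>(Basis::'b set). B)" by (intro sum_mono) (simp add: Gb g(2))
    finally show ?thesis by simp
  qed
  moreover have "norm (G x - G y) \<le> DIM('b) * C * dist x y" for x y
  proof -
    have "norm (G x - G y) \<le> (\<Sum>b\<in>Basis. \<bar>(G x - G y) \<bullet> b\<bar>)" by (rule norm_le_l1)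
    also have "\<dots> \<le> (\<Sum>b\<in>(Basis::'b set). C * dist x y)"
      by (intro sum_mono) (simp add: inner_diff_left Gb g(3))
    finally show ?thesis by simp
  qed
  ultimately show ?thesis by blast
qed

text \<open>Passing from the boundary points \<open>q\<close>, \<open>p\<close> to the centers \<open>x = q + r *\<^sub>R \<nu>\<close>, \<open>y = p + r *\<^sub>R \<nu>'\<close>
  costs a factor in the Lipschitz constant, since \<open>|q - p|\<close> may exceed \<open>|x - y|\<close> by
  \<open>r |\<nu> - \<nu>'|\<close>; as \<open>r\<close> is at most a quarter of the reach, the factor is bounded. For \<open>x = y\<close> the
  estimate shows that the normal does not depend on the choice of the contact point.\<close>

lemma inward_normal_field:
  fixes \<Omega> :: "'a::euclidean_space set"
  assumes \<Omega>: "open \<Omega>" "bounded \<Omega>" "C3_boundary \<Omega>" and r: "0 < r" "r \<le> reach (frontier \<Omega>) / 4"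
  shows "\<exists>V. (\<forall>x. norm (V x) \<le> DIM('a)) \<and>
    (\<forall>x y. norm (V x - V y) \<le> DIM('a) * (4 / reach (frontier \<Omega>)) * dist x y) \<and>
    (\<forall>x q. ball x r \<subseteq> \<Omega> \<and> q \<in> frontier \<Omega> \<and> dist x q = r \<longrightarrow>
        norm (V x) = 1 \<and> x - q = r *\<^sub>R V x \<and> outer_normal \<Omega> q = - V x)"
proof -
  define L where "L = reach (frontier \<Omega>)"
  define s where "s = L / 2"
  have L: "L > 0" using r by (simp add: L_def)
  have s: "0 < s" "s < L" "r < L" "2 * r \<le> s" using r by (simp_all add: s_def L_def)
  define contact where "contact x q \<longleftrightarrow> ball x r \<subseteq> \<Omega> \<and> q \<in> frontier \<Omega> \<and> dist x q = r" for x q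
  define \<nu> where "\<nu> x q = (x - q) /\<^sub>R r" for x q :: 'a
  have nu: "norm (\<nu> x q) = 1" "x = q + r *\<^sub>R \<nu> x q" if "contact x q" for x q
    using that r by (simp_all add: \<nu>_def contact_def dist_norm)
  have balls: "ball (q + s *\<^sub>R \<nu> x q) s \<subseteq> \<Omega>" "ball (q - s *\<^sub>R \<nu> x q) s \<inter> \<Omega> = {}"
    if c: "contact x q" for x q
  proof -
    have "\<Omega> \<noteq> {}" using c r by (auto simp: contact_def)
    then have uniq: "unique_projection (frontier \<Omega>) L"
      unfolding L_def using \<Omega> by (intro unique_projection_reach)
    have inside: "ball (q + r *\<^sub>R \<nu> x q) r \<subseteq> \<Omega>" using c nu(2)[OF c] by (simp add: contact_def)
    have q: "q \<in> frontier \<Omega>" using c by (simp add: contact_def)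
    show "ball (q + s *\<^sub>R \<nu> x q) s \<subseteq> \<Omega>" "ball (q - s *\<^sub>R \<nu> x q) s \<inter> \<Omega> = {}"
      using tangent_balls[OF \<Omega> uniq q nu(1)[OF c] r(1) s(3) inside s(1,2)] by auto
  qed
  have outer: "outer_normal \<Omega> q = - \<nu> x q" if c: "contact x q" for x q
    using c balls[OF c] nu[OF c] by (intro outer_normal_eq[OF \<Omega>(1) _ s(1)]) (auto simp: contact_def)
  have lip: "norm (\<nu> x q - \<nu> y p) \<le> 4 / L * dist x y" if c: "contact x q" "contact y p" for x y q p
  proof -
    have "s * norm (\<nu> x q - \<nu> y p) \<le> norm (q - p)"
      using balls[OF c(1)] balls[OF c(2)]
      by (intro normals_lipschitz nu c s) blast+
    also have "q - p = (x - y) - r *\<^sub>R (\<nu> x q - \<nu> y p)"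
      using nu(2)[OF c(1)] nu(2)[OF c(2)] by (simp add: algebra_simps)
    also have "norm \<dots> \<le> dist x y + r * norm (\<nu> x q - \<nu> y p)"
      using norm_triangle_ineq4[of "x - y" "r *\<^sub>R (\<nu> x q - \<nu> y p)"] r by (simp add: dist_norm)
    finally have "(s - r) * norm (\<nu> x q - \<nu> y p) \<le> dist x y" by (simp add: algebra_simps)
    moreover have "(s / 2) * norm (\<nu> x q - \<nu> y p) \<le> (s - r) * norm (\<nu> x q - \<nu> y p)"
      using s by (intro mult_right_mono) auto
    ultimately have "(L / 4) * norm (\<nu> x q - \<nu> y p) \<le> dist x y" by (simp add: s_def)
    then show ?thesis using L by (simp add: field_simps)
  qed
  define A where "A = {x. \<exists>q. contact x q}"
  define f where "f x = \<nu> x (SOME q. contact x q)" for x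
  have some: "contact x (SOME q. contact x q)" if "x \<in> A" for x
    using that unfolding A_def by (auto intro: someI)
  have "\<exists>V. (\<forall>x\<in>A. V x = f x) \<and> (\<forall>x. norm (V x) \<le> real DIM('a) * 1) \<and>
             (\<forall>x y. norm (V x - V y) \<le> DIM('a) * (4 / L) * dist x y)"
    using L some lip nu(1) by (intro bounded_lipschitz_extension_euclidean) (auto simp: f_def)
  then obtain V where V: "\<And>x. x \<in> A \<Longrightarrow> V x = f x" "\<And>x. norm (V x) \<le> DIM('a)"
      "\<And>x y. norm (V x - V y) \<le> DIM('a) * (4 / L) * dist x y" by auto
  have "V x = \<nu> x q" if c: "contact x q" for x q
  proof -
    have "x \<in> A" using c by (auto simp: A_def)
    then show ?thesis using V(1) lip[OF some c, of x] by (simp add: f_def)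
  qed
  then have "norm (V x) = 1 \<and> x - q = r *\<^sub>R V x \<and> outer_normal \<Omega> q = - V x" if "contact x q" for x q
    using nu[OF that] outer[OF that] that by (metis add_diff_cancel_left')
  then show ?thesis using V(2,3) unfolding contact_def L_def by blast
qed

section \<open>A monotone repulsion field\<close>

lemma inner_sgn_self: "c \<bullet> sgn c = norm (c :: 'a::real_inner)"
  by (cases "c = 0") (simp_all add: sgn_div_norm power2_norm_eq_inner[symmetric] power2_eq_square)

text \<open>\<open>sgn\<close> is the gradient of the norm, which is convex. The value \<open>sgn 0 = 0\<close> is one of the
  subgradients at the singular point.\<close>

lemma sgn_monotone:
  fixes a b :: "'a::real_inner"
  shows "0 \<le> (a - b) \<bullet> (sgn a - sgn b)"
proof -
  have cs: "c \<bullet> sgn d \<le> norm c" for c d :: 'a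
    using norm_cauchy_schwarz[of c "sgn d"] by (cases "d = 0") (simp_all add: norm_sgn)
  show ?thesis using inner_sgn_self[of a] inner_sgn_self[of b] cs[of a b] cs[of b a]
    by (simp add: inner_diff_left inner_diff_right)
qed

text \<open>The gradient of \<open>\<Sum>k<N. |y\<^sub>i - y\<^sub>k|\<close> with respect to \<open>y\<^sub>i\<close>. The term \<open>k = i\<close> vanishes.\<close>

definition repulsion :: "nat \<Rightarrow> (nat \<Rightarrow> 'a::real_inner) \<Rightarrow> nat \<Rightarrow> 'a" where
  "repulsion N y i = (\<Sum>k<N. sgn (y i - y k))"

lemma norm_repulsion_le: "norm (repulsion N y i) \<le> real N"
proof -
  have "norm (repulsion N y i) \<le> (\<Sum>k<N. 1)"
    unfolding repulsion_def by (intro order_trans[OF norm_sum] sum_mono) (simp add: norm_sgn)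
  then show ?thesis by simp
qed

text \<open>The interactions are opposite to each other, so the sum can be written in terms of relative
  velocities.\<close>

lemma sum_inner_repulsion:
  "2 * (\<Sum>i<N. w i \<bullet> repulsion N y i) = (\<Sum>i<N. \<Sum>k<N. (w i - w k) \<bullet> sgn (y i - y k))"
proof -
  have "(\<Sum>i<N. \<Sum>k<N. w k \<bullet> sgn (y i - y k)) = (\<Sum>k<N. \<Sum>i<N. w k \<bullet> sgn (y i - y k))"
    by (rule sum.swap)
  also have "\<dots> = (\<Sum>k<N. \<Sum>i<N. - (w k \<bullet> sgn (y k - y i)))"
    by (intro sum.cong refl) (metis inner_minus_right minus_diff_eq sgn_minus)
  also have "\<dots> = - (\<Sum>i<N. w i \<bullet> repulsion N y i)"
    by (simp add: repulsion_def inner_sum_right sum_negf)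
  finally show ?thesis
    by (simp add: inner_diff_left sum_subtractf repulsion_def inner_sum_right)
qed

text \<open>In free flight the relative position of each pair moves in the direction of the relative velocity,
  and \<open>sgn\<close> is monotone.\<close>

lemma repulsion_free_flight:
  assumes "\<tau> \<ge> 0"
  shows "(\<Sum>i<N. v i \<bullet> repulsion N y i) \<le> (\<Sum>i<N. v i \<bullet> repulsion N (\<lambda>k. y k + \<tau> *\<^sub>R v k) i)"
proof -
  have "(v i - v k) \<bullet> sgn (y i - y k) \<le> (v i - v k) \<bullet> sgn (y i + \<tau> *\<^sub>R v i - (y k + \<tau> *\<^sub>R v k))" for i k
  proof (cases "\<tau> = 0")
    case False
    define e where "e = y i - y k"
    define w where "w = v i - v k"
    have eq: "y i + \<tau> *\<^sub>R v i - (y k + \<tau> *\<^sub>R v k) = e + \<tau> *\<^sub>R w"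
      by (simp add: e_def w_def algebra_simps)
    have "0 \<le> \<tau> * (w \<bullet> (sgn (e + \<tau> *\<^sub>R w) - sgn e))"
      using sgn_monotone[of "e + \<tau> *\<^sub>R w" e] by simp
    then have "0 \<le> w \<bullet> (sgn (e + \<tau> *\<^sub>R w) - sgn e)"
      using assms False by (simp add: zero_le_mult_iff)
    then show ?thesis unfolding eq by (simp add: e_def w_def inner_diff_right)
  qed simp
  then have "2 * (\<Sum>i<N. v i \<bullet> repulsion N y i)
      \<le> 2 * (\<Sum>i<N. v i \<bullet> repulsion N (\<lambda>k. y k + \<tau> *\<^sub>R v k) i)"
    unfolding sum_inner_repulsion by (intro sum_mono)
  then show ?thesis by simp
qed

text \<open>Each third particle contributes a nonnegative term, by monotonicity of \<open>sgn\<close> at the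
  relative positions \<open>y i - y k\<close> and \<open>y j - y k\<close>, whose difference is \<open>y i - y j\<close>. The two
  terms \<open>k = i\<close> and \<open>k = j\<close> are the mutual repulsion of the pair.\<close>

lemma repulsion_collision:
  assumes "i < N" "j < N" "i \<noteq> j"
  shows "2 * norm (y i - y j) \<le> (y i - y j) \<bullet> (repulsion N y i - repulsion N y j)"
proof -
  define e where "e = y i - y j"
  define g where "g k = e \<bullet> (sgn (y i - y k) - sgn (y j - y k))" for k
  have "g i = norm e" "g j = norm e"
    using inner_sgn_self[of e] sgn_minus[of e] by (simp_all add: g_def e_def)
  then have "2 * norm e = sum g {i, j}" using assms(3) by simp
  also have "\<dots> \<le> sum g {..<N}"
  proof (rule sum_mono2)
    fix k
    show "0 \<le> g k" using sgn_monotone[of "y i - y k" "y j - y k"] by (simp add: g_def e_def)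
  qed (use assms in auto)
  also have "\<dots> = e \<bullet> (repulsion N y i - repulsion N y j)"
    by (simp add: g_def repulsion_def inner_diff_right inner_sum_right sum_subtractf)
  finally show ?thesis by (simp add: e_def)
qed

section \<open>Bookkeeping of the collisions\<close>

definition colliding_pairs :: "nat \<Rightarrow> real \<Rightarrow> (nat \<Rightarrow> real \<Rightarrow> 'a::euclidean_space) \<Rightarrow> real \<Rightarrow> (nat \<times> nat) set" where
  "colliding_pairs N r x s = {(i, j). i < j \<and> j < N \<and> pair_collision r x i j s}"

definition at_wall ::
    "'a::euclidean_space set \<Rightarrow> nat \<Rightarrow> real \<Rightarrow> (nat \<Rightarrow> real \<Rightarrow> 'a) \<Rightarrow> real \<Rightarrow> nat set" where
  "at_wall \<Omega> N r x s = {j. j < N \<and> wall_collision \<Omega> r x j s}"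

definition jump_sum ::
    "'a::euclidean_space set \<Rightarrow> nat \<Rightarrow> real \<Rightarrow> (nat \<Rightarrow> real \<Rightarrow> 'a) \<Rightarrow> (nat \<Rightarrow> real \<Rightarrow> 'a) \<Rightarrow> real \<Rightarrow> real" where
  "jump_sum \<Omega> N r x u s =
     (\<Sum>(i, j)\<in>colliding_pairs N r x s. norm (u i s - u_in u i s)) +
     (\<Sum>j\<in>at_wall \<Omega> N r x s. norm (u j s - u_in u j s))"

lemma finite_colliding_pairs [simp]: "finite (colliding_pairs N r x s)"
  by (rule finite_subset[of _ "{..<N} \<times> {..<N}"]) (auto simp: colliding_pairs_def)

lemma finite_at_wall [simp]: "finite (at_wall \<Omega> N r x s)"
  by (simp add: at_wall_def)

lemma jump_sum_nonneg: "0 \<le> jump_sum \<Omega> N r x u s"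
  unfolding jump_sum_def by (intro add_nonneg_nonneg sum_nonneg) auto

lemma pair_collision_sym: "pair_collision r x i j s \<longleftrightarrow> pair_collision r x j i s"
  by (auto simp: pair_collision_def dist_commute)

text \<open>Several collisions may take place simultaneously, but they involve disjoint sets of particles: a
  colliding particle has exactly one partner, or is at the wall. Each unordered pair is
  represented in \<open>colliding_pairs\<close> once and appears in the sum over ordered pairs \<open>Q\<close> twice, once for each particle.\<close>

lemma sum_by_collisions:
  fixes f :: "nat \<Rightarrow> real"
  assumes gen: "generic_collisions \<Omega> N r x" and s: "s > 0"
    and zero: "\<And>i. \<lbrakk>i < N; \<not> collides \<Omega> N r x i s\<rbrakk> \<Longrightarrow> f i = 0"
  shows "(\<Sum>i<N. f i) = (\<Sum>(i, j)\<in>colliding_pairs N r x s. f i + f j) + (\<Sum>j\<in>at_wall \<Omega> N r x s. f j)"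
proof -
  let ?p = "\<lambda>i k. pair_collision r x i k s" and ?w = "\<lambda>i. wall_collision \<Omega> r x i s"
  let ?P = "colliding_pairs N r x s"
  define Q where "Q = {(i, k). i < N \<and> k < N \<and> ?p i k}"
  have split: "f i = (\<Sum>k<N. if ?p i k then f i else 0) + (if ?w i then f i else 0)" if i: "i < N" for i
  proof (cases "\<exists>k<N. ?p k i")
    case True
    then obtain k where k: "k < N" "?p k i" by blast
    have "?p i k' \<longleftrightarrow> k' = k" if "k' < N" for k'
      using gen s i k that unfolding generic_collisions_def by (metis pair_collision_sym)
    then have "(\<Sum>k'<N. if ?p i k' then f i else 0) = (\<Sum>k'<N. if k' = k then f i else 0)"
      by (intro sum.cong) auto
    moreover have "\<not> ?w i" using gen s i k unfolding generic_collisions_def by blast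
    ultimately show ?thesis using k(1) by simp
  next
    case False
    then have "(\<Sum>k<N. if ?p i k then f i else 0) = 0"
      using pair_collision_sym[of r x i _ s] by (intro sum.neutral) auto
    moreover have "f i = 0" if "\<not> ?w i" using zero[OF i] False that by (auto simp: collides_def)
    ultimately show ?thesis by auto
  qed
  have "(\<Sum>i<N. f i) = (\<Sum>i<N. (\<Sum>k<N. if ?p i k then f i else 0) + (if ?w i then f i else 0))"
    using split by (intro sum.cong) auto
  also have "\<dots> = (\<Sum>i<N. \<Sum>k<N. if ?p i k then f i else 0) + (\<Sum>i<N. if ?w i then f i else 0)"
    by (rule sum.distrib)
  also have "(\<Sum>i<N. if ?w i then f i else 0) = (\<Sum>j\<in>at_wall \<Omega> N r x s. f j)"
  proof -
    have "at_wall \<Omega> N r x s = {i \<in> {..<N}. ?w i}" by (auto simp: at_wall_def)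
    then show ?thesis by (simp only: sum.inter_filter[OF finite_lessThan])
  qed
  also have "(\<Sum>i<N. \<Sum>k<N. if ?p i k then f i else 0) = (\<Sum>z\<in>{..<N} \<times> {..<N}. if ?p (fst z) (snd z) then f (fst z) else 0)"
    by (simp add: sum.cartesian_product case_prod_beta)
  also have "\<dots> = (\<Sum>z\<in>Q. f (fst z))"
  proof -
    have "Q = {z \<in> {..<N} \<times> {..<N}. ?p (fst z) (snd z)}" by (auto simp: Q_def)
    then show ?thesis by (simp add: sum.inter_filter)
  qed
  also have "Q = ?P \<union> prod.swap ` ?P"
  proof -
    have "(i, k) \<in> Q \<longleftrightarrow> (i, k) \<in> ?P \<or> (k, i) \<in> ?P" for i k
      using pair_collision_sym[of r x i k s]
      by (auto simp: Q_def colliding_pairs_def pair_collision_def)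
    moreover have "(i, k) \<in> prod.swap ` ?P \<longleftrightarrow> (k, i) \<in> ?P" for i k by force
    ultimately show ?thesis by auto
  qed
  also have "(\<Sum>z\<in>?P \<union> prod.swap ` ?P. f (fst z)) = (\<Sum>z\<in>?P. f (fst z)) + (\<Sum>z\<in>prod.swap ` ?P. f (fst z))"
  proof (rule sum.union_disjoint)
    show "?P \<inter> prod.swap ` ?P = {}" by (auto simp: colliding_pairs_def)
  qed simp_all
  also have "(\<Sum>z\<in>prod.swap ` ?P. f (fst z)) = (\<Sum>z\<in>?P. f (snd z))"
    by (subst sum.reindex) (auto simp: inj_on_def)
  also have "(\<Sum>z\<in>?P. f (fst z)) + (\<Sum>z\<in>?P. f (snd z)) = (\<Sum>(i, j)\<in>?P. f i + f j)"
    by (simp add: sum.distrib case_prod_beta)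
  finally show ?thesis .
qed

lemma collision_sum_eq:
  assumes gen: "generic_collisions \<Omega> N r x" and "t \<ge> 0"
  shows "collision_sum \<Omega> N r x u t t' =
    (\<Sum>s | t < s \<and> s < t' \<and> (\<exists>j<N. collides \<Omega> N r x j s). jump_sum \<Omega> N r x u s)"
proof -
  define S where "S = {s. t < s \<and> s < t' \<and> (\<exists>j<N. collides \<Omega> N r x j s)}"
  have "finite {s\<in>{0<..t'}. \<exists>j<N. collides \<Omega> N r x j s}"
    using gen unfolding generic_collisions_def by blast
  then have fin: "finite S" by (rule rev_finite_subset) (use \<open>t \<ge> 0\<close> in \<open>auto simp: S_def\<close>)
  have pS: "s \<in> S" if "t < s" "s < t'" "i < j" "j < N" "pair_collision r x i j s" for s i j
  proof -
    have "collides \<Omega> N r x j s" using that by (auto simp: collides_def intro!: exI[of _ i])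
    then show ?thesis using that by (auto simp: S_def)
  qed
  have wS: "s \<in> S" if "t < s" "s < t'" "j < N" "wall_collision \<Omega> r x j s" for s j
    using that by (auto simp: S_def collides_def intro!: exI[of _ j])
  have "(\<Sum>(i, j, s)\<in>{(i, j, s). i < j \<and> j < N \<and> t < s \<and> s < t' \<and> pair_collision r x i j s}. norm (u i s - u_in u i s))
      = (\<Sum>(s, i, j)\<in>Sigma S (colliding_pairs N r x). norm (u i s - u_in u i s))"
    by (rule sum.reindex_bij_witness[of _ "\<lambda>(s, i, j). (i, j, s)" "\<lambda>(i, j, s). (s, i, j)"])
      (use pS in \<open>auto simp: S_def colliding_pairs_def\<close>)
  also have "\<dots> = (\<Sum>s\<in>S. \<Sum>(i, j)\<in>colliding_pairs N r x s. norm (u i s - u_in u i s))"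
    using fin by (subst sum.Sigma[symmetric]) (auto simp: case_prod_beta)
  finally have 1: "(\<Sum>(i, j, s)\<in>{(i, j, s). i < j \<and> j < N \<and> t < s \<and> s < t' \<and> pair_collision r x i j s}. norm (u i s - u_in u i s))
     = (\<Sum>s\<in>S. \<Sum>(i, j)\<in>colliding_pairs N r x s. norm (u i s - u_in u i s))" .
  have "(\<Sum>(j, s)\<in>{(j, s). j < N \<and> t < s \<and> s < t' \<and> wall_collision \<Omega> r x j s}. norm (u j s - u_in u j s))
      = (\<Sum>(s, j)\<in>Sigma S (at_wall \<Omega> N r x). norm (u j s - u_in u j s))"
    by (rule sum.reindex_bij_witness[of _ "\<lambda>(s, j). (j, s)" "\<lambda>(j, s). (s, j)"])
      (use wS in \<open>auto simp: S_def at_wall_def\<close>)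
  also have "\<dots> = (\<Sum>s\<in>S. \<Sum>j\<in>at_wall \<Omega> N r x s. norm (u j s - u_in u j s))"
    using fin by (subst sum.Sigma[symmetric]) auto
  finally show ?thesis
    unfolding collision_sum_def 1 by (simp add: jump_sum_def sum.distrib flip: S_def)
qed

section \<open>The virial of a hard spheres flow\<close>

text \<open>\<open>e\<close> stands for the vector from an obstacle to the particle at the time of contact, \<open>w\<close> for the
  incoming relative velocity. A positive \<open>e \<bullet> w\<close> would mean an overlap just before the contact.\<close>

lemma approaching_before_contact:
  fixes e w :: "'a::real_inner"
  assumes "T > 0" and far: "\<And>\<tau>. \<lbrakk>0 < \<tau>; \<tau> < T\<rbrakk> \<Longrightarrow> norm e \<le> norm (e - \<tau> *\<^sub>R w)"
  shows "e \<bullet> w \<le> 0"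
proof (rule ccontr)
  assume "\<not> e \<bullet> w \<le> 0"
  then have ew: "e \<bullet> w > 0" by simp
  then have ww: "w \<bullet> w > 0" by auto
  define \<tau> where "\<tau> = min (T / 2) ((e \<bullet> w) / (w \<bullet> w))"
  have \<tau>: "0 < \<tau>" "\<tau> < T" using \<open>T > 0\<close> ew ww by (auto simp: \<tau>_def)
  have "\<tau> \<le> (e \<bullet> w) / (w \<bullet> w)" by (simp add: \<tau>_def)
  then have "\<tau> * (w \<bullet> w) \<le> e \<bullet> w" using ww by (simp add: pos_le_divide_eq)
  then have "\<tau> * (\<tau> * (w \<bullet> w)) \<le> \<tau> * (e \<bullet> w)" using \<tau> by (intro mult_left_mono) auto
  moreover have "0 < \<tau> * (e \<bullet> w)" using \<tau> ew by simp
  moreover have "(norm e)\<^sup>2 \<le> (norm (e - \<tau> *\<^sub>R w))\<^sup>2" using far[OF \<tau>] by (simp add: power_mono)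
  moreover have "(norm (e - \<tau> *\<^sub>R w))\<^sup>2 = (norm e)\<^sup>2 - 2 * (\<tau> * (e \<bullet> w)) + \<tau> * (\<tau> * (w \<bullet> w))"
    unfolding power2_norm_eq_inner by (simp add: inner_diff inner_commute algebra_simps)
  ultimately show False by linarith
qed

text \<open>The field \<open>V\<close> is only constrained to be normal at centers of balls that touch the boundary. The
  smallness condition guarantees that the variation of \<open>2 N V\<close> over the distance \<open>2 r\<close> of two
  colliding particles consumes at most half of the gain from their repulsion.\<close>

locale hard_spheres_with_normal_field =
  fixes \<Omega> :: "'a::euclidean_space set" and N :: nat and r :: real
    and x u :: "nat \<Rightarrow> real \<Rightarrow> 'a" and V :: "'a \<Rightarrow> 'a" and B \<Lambda> :: real
  assumes open_dom: "open \<Omega>" and radius: "r > 0"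
    and dynamics: "hard_spheres \<Omega> N r x u"
    and generic: "generic_collisions \<Omega> N r x"
    and field_bound: "norm (V y) \<le> B"
    and field_lipschitz: "norm (V y - V z) \<le> \<Lambda> * dist y z"
    and field_contact: "\<lbrakk>ball y r \<subseteq> \<Omega>; q \<in> frontier \<Omega>; dist y q = r\<rbrakk>
      \<Longrightarrow> norm (V y) = 1 \<and> y - q = r *\<^sub>R V y \<and> outer_normal \<Omega> q = - V y"
    and small: "4 * N * r * \<Lambda> \<le> 1" "\<Lambda> \<ge> 0"
begin

text \<open>The weight \<open>2 N\<close> exceeds by at least \<open>N\<close> the norm of the repulsion, which may point towards the wall.\<close>

definition field :: "real \<Rightarrow> nat \<Rightarrow> 'a" where
  "field t i = repulsion N (\<lambda>k. x k t) i + (2 * real N) *\<^sub>R V (x i t)"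

definition virial :: "real \<Rightarrow> real" where
  "virial t = (\<Sum>i<N. u i t \<bullet> field t i)"

lemma centers_inside: "\<lbrakk>t \<ge> 0; j < N\<rbrakk> \<Longrightarrow> ball (x j t) r \<subseteq> \<Omega>"
  using dynamics by (simp add: hard_spheres_def)

lemma exclusion: "\<lbrakk>t \<ge> 0; i < N; j < N; i \<noteq> j\<rbrakk> \<Longrightarrow> 2 * r \<le> dist (x i t) (x j t)"
  using dynamics by (simp add: hard_spheres_def)

text \<open>A time interval without collisions in its interior; collisions may take place at the end point \<open>b\<close>.\<close>

context
  fixes a b :: real
  assumes ab: "0 \<le> a" "a < b"
    and free: "\<And>s j. \<lbrakk>a < s; s < b; j < N\<rbrakk> \<Longrightarrow> \<not> collides \<Omega> N r x j s"
begin

lemma flight: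
  assumes "j < N" "a \<le> s" "s \<le> b"
  shows "x j s = x j a + (s - a) *\<^sub>R u j a"
proof -
  have "\<forall>s'\<in>{a<..<s}. \<not> collides \<Omega> N r x j s'" using free assms by auto
  then show ?thesis using dynamics ab assms unfolding hard_spheres_def by blast
qed

lemma velocity_in:
  assumes j: "j < N"
  shows "u_in u j b = u j a"
proof -
  have "u j s = u j a" if s: "a < s" "s < b" for s
  proof -
    have "\<forall>s'\<in>{a<..<s}. \<not> collides \<Omega> N r x j s'" "\<not> collides \<Omega> N r x j s"
      using free j s by auto
    then show ?thesis using dynamics ab j s(1) less_imp_le[OF s(1)] unfolding hard_spheres_def by blast
  qed
  then have "\<forall>\<^sub>F s in at_left b. u j s = u j a"
    using ab by (intro eventually_at_leftI[of a b]) auto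
  then have "(u j \<longlongrightarrow> u j a) (at_left b)" by (rule tendsto_eventually)
  then show ?thesis unfolding u_in_def by (intro tendsto_Lim) auto
qed

lemma velocity_unchanged:
  assumes "j < N" "\<not> collides \<Omega> N r x j b"
  shows "u j b = u_in u j b"
proof -
  have "\<forall>s'\<in>{a<..<b}. \<not> collides \<Omega> N r x j s'" using free assms(1) by auto
  then have "u j b = u j a"
    using dynamics ab assms less_imp_le[OF ab(2)] unfolding hard_spheres_def by blast
  then show ?thesis using velocity_in[OF assms(1)] by simp
qed

lemma position_before:
  assumes "j < N" "0 < \<tau>" "\<tau> < b - a"
  shows "x j (b - \<tau>) = x j b - \<tau> *\<^sub>R u_in u j b"
proof -
  have before: "x j (b - \<tau>) = x j a + (b - \<tau> - a) *\<^sub>R u j a" and at_b: "x j b = x j a + (b - a) *\<^sub>R u j a"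
    using assms ab by (auto intro!: flight)
  show ?thesis unfolding before at_b velocity_in[OF assms(1)] by (simp add: algebra_simps)
qed

text \<open>Conservation of energy leaves two values for the coefficient \<open>\<alpha>\<close>, one of which is \<open>0\<close>. The other
  one has the sign opposite to \<open>e \<bullet> w\<close>, where the relative velocity \<open>w\<close> is that of approaching
  particles.\<close>

lemma pair_jump:
  assumes ij: "i < N" "j < N" and coll: "pair_collision r x i j b"
  obtains \<alpha> where "\<alpha> \<ge> 0" "u i b - u_in u i b = \<alpha> *\<^sub>R (x i b - x j b)"
    "u j b - u_in u j b = - \<alpha> *\<^sub>R (x i b - x j b)"
    "(norm (u i b))\<^sup>2 + (norm (u j b))\<^sup>2 = (norm (u_in u i b))\<^sup>2 + (norm (u_in u j b))\<^sup>2"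
proof -
  define e where "e = x i b - x j b"
  define w where "w = u_in u i b - u_in u j b"
  have e: "norm e = 2 * r" "i \<noteq> j" using coll by (auto simp: pair_collision_def e_def dist_norm)
  have law: "elastic_law x u i j b"
    using dynamics ij coll ab unfolding hard_spheres_def by (meson le_less_trans)
  then obtain \<alpha> where \<alpha>: "u i b - u_in u i b = \<alpha> *\<^sub>R e" by (auto simp: elastic_law_def e_def)
  have en: "(norm (u i b))\<^sup>2 + (norm (u j b))\<^sup>2 = (norm (u_in u i b))\<^sup>2 + (norm (u_in u j b))\<^sup>2"
    and mom: "u i b + u j b = u_in u i b + u_in u j b" using law by (auto simp: elastic_law_def)
  have ui: "u i b = u_in u i b + \<alpha> *\<^sub>R e" using \<alpha> by (simp add: algebra_simps)
  have uj: "u j b = u_in u j b - \<alpha> *\<^sub>R e" using mom unfolding ui by (simp add: algebra_simps)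
  have "e \<bullet> w \<le> 0"
  proof (rule approaching_before_contact)
    fix \<tau> assume \<tau>: "0 < \<tau>" "\<tau> < b - a"
    have "2 * r \<le> dist (x i (b - \<tau>)) (x j (b - \<tau>))" using \<tau> ab ij e by (intro exclusion) auto
    also have "\<dots> = norm (e - \<tau> *\<^sub>R w)"
      by (simp add: dist_norm position_before[OF ij(1) \<tau>] position_before[OF ij(2) \<tau>] e_def w_def
          algebra_simps)
    finally show "norm e \<le> norm (e - \<tau> *\<^sub>R w)" using e by simp
  qed (use ab in auto)
  moreover have "\<alpha> * (e \<bullet> w + \<alpha> * (norm e)\<^sup>2) = 0"
    using en unfolding ui uj power2_norm_eq_inner w_def
    by (simp add: inner_add inner_diff inner_commute algebra_simps)
  moreover have "(norm e)\<^sup>2 > 0" using e radius by simp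
  ultimately have "\<alpha> \<ge> 0"
    by (smt (verit) mult_eq_0_iff mult_neg_pos)
  then show thesis using that \<alpha> uj en by (simp add: e_def)
qed

text \<open>The jump points inwards because the particle reaches the wall with a velocity that points outwards.\<close>

lemma wall_jump:
  assumes j: "j < N" and coll: "wall_collision \<Omega> r x j b"
  obtains \<beta> where "\<beta> \<ge> 0" "u j b - u_in u j b = \<beta> *\<^sub>R V (x j b)" "norm (V (x j b)) = 1"
    "(norm (u j b))\<^sup>2 = (norm (u_in u j b))\<^sup>2"
proof -
  obtain q where q: "contact_point \<Omega> r x j b q" using coll by (auto simp: wall_collision_def)
  define \<nu> where "\<nu> = V (x j b)"
  define w where "w = u_in u j b"
  have in_b: "ball (x j b) r \<subseteq> \<Omega>" using j ab by (intro centers_inside) auto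
  have \<nu>: "norm \<nu> = 1" "x j b - q = r *\<^sub>R \<nu>" "outer_normal \<Omega> q = - \<nu>"
    using field_contact[OF in_b, of q] q by (auto simp: contact_point_def \<nu>_def)
  have "specular_law u j b (outer_normal \<Omega> q)"
    using dynamics j q ab unfolding hard_spheres_def by (meson le_less_trans)
  then have 1: "u j b \<bullet> \<nu> = - (w \<bullet> \<nu>)" and 2: "u j b - (u j b \<bullet> \<nu>) *\<^sub>R \<nu> = w - (w \<bullet> \<nu>) *\<^sub>R \<nu>"
    unfolding specular_law_def \<nu>(3) w_def by simp_all
  define \<beta> where "\<beta> = - 2 * (w \<bullet> \<nu>)"
  have ub: "u j b = w + \<beta> *\<^sub>R \<nu>"
  proof -
    have "u j b = w - (w \<bullet> \<nu>) *\<^sub>R \<nu> + (u j b \<bullet> \<nu>) *\<^sub>R \<nu>" using 2 by (simp add: algebra_simps)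
    then show ?thesis unfolding 1 by (simp add: \<beta>_def algebra_simps scaleR_2 flip: scaleR_scaleR)
  qed
  have "q \<notin> \<Omega>" using q open_dom by (simp add: contact_point_def frontier_def interior_open)
  have "(x j b - q) \<bullet> w \<le> 0"
  proof (rule approaching_before_contact)
    fix \<tau> assume \<tau>: "0 < \<tau>" "\<tau> < b - a"
    have "ball (x j (b - \<tau>)) r \<subseteq> \<Omega>" using \<tau> ab j by (intro centers_inside) auto
    then have "r \<le> dist (x j (b - \<tau>)) q" using \<open>q \<notin> \<Omega>\<close> by (force simp: not_less[symmetric])
    also have "\<dots> = norm (x j b - q - \<tau> *\<^sub>R w)"
      by (simp add: dist_norm position_before[OF j \<tau>] w_def algebra_simps)
    finally show "norm (x j b - q) \<le> norm (x j b - q - \<tau> *\<^sub>R w)"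
      using q by (simp add: contact_point_def dist_norm)
  qed (use ab in auto)
  then have "w \<bullet> \<nu> \<le> 0" using \<nu>(2) radius by (simp add: mult_le_0_iff inner_commute)
  then have "\<beta> \<ge> 0" by (simp add: \<beta>_def)
  moreover have "(norm (u j b))\<^sup>2 = (norm w)\<^sup>2"
  proof -
    have "\<nu> \<bullet> \<nu> = 1" using \<nu>(1) by (simp add: norm_eq_1)
    then show ?thesis unfolding ub power2_norm_eq_inner
      by (simp add: \<beta>_def inner_add inner_commute algebra_simps)
  qed
  ultimately show thesis using that ub \<nu>(1) by (simp add: \<nu>_def w_def)
qed

lemma energy_step: "(\<Sum>i<N. (norm (u i b))\<^sup>2) = (\<Sum>i<N. (norm (u i a))\<^sup>2)"
proof -
  let ?f = "\<lambda>i. (norm (u i b))\<^sup>2 - (norm (u_in u i b))\<^sup>2"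
  have b: "b > 0" using ab by simp
  have "(\<Sum>i<N. ?f i) = (\<Sum>(i, j)\<in>colliding_pairs N r x b. ?f i + ?f j) + (\<Sum>j\<in>at_wall \<Omega> N r x b. ?f j)"
    using velocity_unchanged by (intro sum_by_collisions[OF generic b]) auto
  also have "(\<Sum>(i, j)\<in>colliding_pairs N r x b. ?f i + ?f j) = 0"
  proof (rule sum.neutral, clarify)
    fix i j assume "(i, j) \<in> colliding_pairs N r x b"
    then show "?f i + ?f j = 0" by (auto simp: colliding_pairs_def elim!: pair_jump[rotated 2])
  qed
  also have "(\<Sum>j\<in>at_wall \<Omega> N r x b. ?f j) = 0"
    by (rule sum.neutral) (auto simp: at_wall_def elim!: wall_jump[rotated])
  finally have "(\<Sum>i<N. (norm (u i b))\<^sup>2) = (\<Sum>i<N. (norm (u_in u i b))\<^sup>2)"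
    by (simp add: sum_subtractf)
  then show ?thesis by (simp add: velocity_in)
qed

lemma jump_sum_le_virial_jump:
  "jump_sum \<Omega> N r x u b \<le> (\<Sum>i<N. (u i b - u_in u i b) \<bullet> field b i)"
proof -
  let ?d = "\<lambda>i. u i b - u_in u i b"
  let ?f = "\<lambda>i. ?d i \<bullet> field b i"
  have b: "b > 0" using ab by simp
  have pair: "norm (?d i) \<le> ?f i + ?f j" if ij: "(i, j) \<in> colliding_pairs N r x b" for i j
  proof -
    have ij: "i < N" "j < N" "i \<noteq> j" "pair_collision r x i j b"
      using that by (auto simp: colliding_pairs_def)
    obtain \<alpha> where \<alpha>: "\<alpha> \<ge> 0" "?d i = \<alpha> *\<^sub>R (x i b - x j b)" "?d j = - \<alpha> *\<^sub>R (x i b - x j b)"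
      using pair_jump[OF ij(1,2,4)] by blast
    define e where "e = x i b - x j b"
    define w where "w = V (x i b) - V (x j b)"
    have e: "norm e = 2 * r" using ij by (simp add: e_def pair_collision_def dist_norm)
    have "norm w \<le> \<Lambda> * norm e" unfolding w_def e_def using field_lipschitz by (simp add: dist_norm)
    then have "norm e * norm w \<le> norm e * (\<Lambda> * norm e)" by (intro mult_left_mono) auto
    then have "- (e \<bullet> w) \<le> norm e * (\<Lambda> * norm e)"
      using norm_cauchy_schwarz[of e "- w"] by simp
    then have "2 * real N * - (e \<bullet> w) \<le> 2 * real N * (norm e * (\<Lambda> * norm e))"
      by (intro mult_left_mono) auto
    also have "\<dots> = (4 * N * r * \<Lambda>) * norm e" using e by (simp add: mult_ac)
    also have "\<dots> \<le> 1 * norm e" using small by (intro mult_right_mono) auto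
    finally have "norm e \<le> 2 * norm e + 2 * real N * (e \<bullet> w)" by simp
    also have "\<dots> \<le> e \<bullet> (field b i - field b j)"
      using repulsion_collision[OF ij(1-3), of "\<lambda>k. x k b"]
      by (simp add: field_def e_def w_def inner_diff_right inner_add_right algebra_simps)
    finally have "\<alpha> * norm e \<le> \<alpha> * (e \<bullet> (field b i - field b j))"
      using \<alpha>(1) by (rule mult_left_mono)
    then show ?thesis unfolding \<alpha>(2,3) using \<alpha>(1) by (simp add: e_def inner_diff_right right_diff_distrib)
  qed
  have wall: "norm (?d j) \<le> ?f j" if "j \<in> at_wall \<Omega> N r x b" for j
  proof -
    have j: "j < N" "wall_collision \<Omega> r x j b" using that by (auto simp: at_wall_def)
    obtain \<beta> where \<beta>: "\<beta> \<ge> 0" "?d j = \<beta> *\<^sub>R V (x j b)" "norm (V (x j b)) = 1"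
      using wall_jump[OF j] by blast
    define \<nu> where "\<nu> = V (x j b)"
    have "- real N \<le> \<nu> \<bullet> repulsion N (\<lambda>k. x k b) j"
      using norm_cauchy_schwarz[of "- \<nu>" "repulsion N (\<lambda>k. x k b) j"] \<beta>(3)
        norm_repulsion_le[of N "\<lambda>k. x k b" j] by (simp add: \<nu>_def)
    moreover have "\<nu> \<bullet> \<nu> = 1" using \<beta>(3) by (simp add: norm_eq_1 \<nu>_def)
    ultimately have "1 \<le> \<nu> \<bullet> field b j" using j(1) by (simp add: field_def inner_add_right \<nu>_def)
    then have "\<beta> * 1 \<le> \<beta> * (\<nu> \<bullet> field b j)" using \<beta>(1) by (rule mult_left_mono)
    then show ?thesis unfolding \<beta>(2) using \<beta> by (simp add: \<nu>_def)
  qed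
  have "jump_sum \<Omega> N r x u b \<le> (\<Sum>(i, j)\<in>colliding_pairs N r x b. ?f i + ?f j) + (\<Sum>j\<in>at_wall \<Omega> N r x b. ?f j)"
    unfolding jump_sum_def using pair wall by (intro add_mono sum_mono) auto
  also have "\<dots> = (\<Sum>i<N. ?f i)"
    using velocity_unchanged by (intro sum_by_collisions[OF generic b, symmetric]) auto
  finally show ?thesis .
qed

text \<open>The change of the virial splits into the jump of the velocities at time \<open>b\<close>, with the field
  frozen at its value at \<open>b\<close>, and the change of the field along the flight, with the velocities
  frozen at their values at \<open>a\<close>. The first controls the jumps and the second is bounded below by the
  Lipschitz constant of \<open>V\<close>.\<close>

lemma virial_step:
  "jump_sum \<Omega> N r x u b \<le>
     virial b - virial a + 2 * N * \<Lambda> * (b - a) * (\<Sum>i<N. (norm (u i a))\<^sup>2)"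
proof -
  define \<tau> where "\<tau> = b - a"
  have \<tau>: "\<tau> > 0" using ab by (simp add: \<tau>_def)
  have xb: "x i b = x i a + \<tau> *\<^sub>R u i a" if "i < N" for i
    using flight[OF that, of b] ab by (simp add: \<tau>_def)
  have "(\<Sum>i<N. u i a \<bullet> repulsion N (\<lambda>k. x k a) i)
      \<le> (\<Sum>i<N. u i a \<bullet> repulsion N (\<lambda>k. x k a + \<tau> *\<^sub>R u k a) i)"
    using \<tau> by (intro repulsion_free_flight) auto
  also have "\<dots> = (\<Sum>i<N. u i a \<bullet> repulsion N (\<lambda>k. x k b) i)"
    by (intro sum.cong) (auto simp: repulsion_def xb)
  finally have rep: "(\<Sum>i<N. u i a \<bullet> repulsion N (\<lambda>k. x k a) i) \<le> (\<Sum>i<N. u i a \<bullet> repulsion N (\<lambda>k. x k b) i)" .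
  have "- (\<Lambda> * \<tau> * (norm (u i a))\<^sup>2) \<le> u i a \<bullet> (V (x i b) - V (x i a))" if "i < N" for i
  proof -
    have "norm (V (x i b) - V (x i a)) \<le> \<Lambda> * (\<tau> * norm (u i a))"
      using field_lipschitz[of "x i b" "x i a"] xb[OF that] \<tau> by (simp add: dist_norm)
    then have "norm (u i a) * norm (V (x i b) - V (x i a)) \<le> norm (u i a) * (\<Lambda> * (\<tau> * norm (u i a)))"
      by (intro mult_left_mono) auto
    then show ?thesis
      using norm_cauchy_schwarz[of "u i a" "- (V (x i b) - V (x i a))"]
      by (simp add: norm_minus_commute inner_diff_right power2_eq_square mult_ac)
  qed
  then have "(\<Sum>i<N. - (\<Lambda> * \<tau> * (norm (u i a))\<^sup>2)) \<le> (\<Sum>i<N. u i a \<bullet> (V (x i b) - V (x i a)))"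
    by (intro sum_mono) auto
  then have "2 * real N * (\<Sum>i<N. - (\<Lambda> * \<tau> * (norm (u i a))\<^sup>2))
      \<le> 2 * real N * (\<Sum>i<N. u i a \<bullet> (V (x i b) - V (x i a)))"
    by (intro mult_left_mono) auto
  then have wallpart: "- (2 * N * \<Lambda> * \<tau> * (\<Sum>i<N. (norm (u i a))\<^sup>2))
      \<le> (\<Sum>i<N. u i a \<bullet> ((2 * real N) *\<^sub>R V (x i b))) - (\<Sum>i<N. u i a \<bullet> ((2 * real N) *\<^sub>R V (x i a)))"
    by (simp add: sum_negf sum_subtractf inner_diff_right sum_distrib_left right_diff_distrib mult_ac)
  have "virial b = (\<Sum>i<N. (u i b - u_in u i b) \<bullet> field b i) + (\<Sum>i<N. u i a \<bullet> field b i)"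
    by (simp add: virial_def velocity_in inner_diff_left sum_subtractf)
  moreover have "(\<Sum>i<N. u i a \<bullet> field b i) - virial a \<ge> - (2 * N * \<Lambda> * \<tau> * (\<Sum>i<N. (norm (u i a))\<^sup>2))"
    using rep wallpart by (simp add: virial_def field_def inner_add_right sum.distrib)
  ultimately show ?thesis using jump_sum_le_virial_jump by (simp add: \<tau>_def)
qed

end

definition collision_times :: "real set \<Rightarrow> real set" where
  "collision_times I = {s \<in> I. \<exists>j<N. collides \<Omega> N r x j s}"

lemma finite_collision_times:
  assumes "0 \<le> a" "I \<subseteq> {a<..b}"
  shows "finite (collision_times I)"
proof -
  have "finite {s\<in>{0<..b}. \<exists>j<N. collides \<Omega> N r x j s}"
    using generic unfolding generic_collisions_def by blast
  then show ?thesis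
    by (rule rev_finite_subset) (use assms in \<open>auto simp: collision_times_def\<close>)
qed

text \<open>Induction on the number of collision times inside the interval, splitting at the last one.\<close>

lemma energy_and_virial:
  assumes "0 \<le> a" "a < b"
  shows "(\<Sum>i<N. (norm (u i b))\<^sup>2) = (\<Sum>i<N. (norm (u i a))\<^sup>2) \<and>
    (\<Sum>s\<in>collision_times {a<..b}. jump_sum \<Omega> N r x u s) \<le>
      virial b - virial a + 2 * N * \<Lambda> * (b - a) * (\<Sum>i<N. (norm (u i a))\<^sup>2)"
  using assms(2)
proof (induction "card (collision_times {a<..<b})" arbitrary: b rule: less_induct)
  case less
  let ?E = "\<lambda>t. \<Sum>i<N. (norm (u i t))\<^sup>2"
  have step: "?E d = ?E c \<and> (\<Sum>s\<in>collision_times {c<..d}. jump_sum \<Omega> N r x u s) \<le>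
      virial d - virial c + 2 * N * \<Lambda> * (d - c) * ?E c"
    if cd: "a \<le> c" "c < d" "collision_times {c<..<d} = {}" for c d
  proof -
    have c: "0 \<le> c" using cd assms(1) by simp
    have fr: "\<not> collides \<Omega> N r x j s" if "c < s" "s < d" "j < N" for s j
      using cd(3) that by (auto simp: collision_times_def)
    have "(\<Sum>s\<in>collision_times {c<..d}. jump_sum \<Omega> N r x u s) \<le> (\<Sum>s\<in>{d}. jump_sum \<Omega> N r x u s)"
      using cd by (intro sum_mono2) (auto simp: collision_times_def less_le jump_sum_nonneg)
    then show ?thesis
      using energy_step[OF c cd(2) fr] virial_step[OF c cd(2) fr] by simp
  qed
  show ?case
  proof (cases "collision_times {a<..<b} = {}")
    case True
    then show ?thesis using step less.prems by blast
  next
    case False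
    have fin: "finite (collision_times {a<..<b})"
      by (rule finite_collision_times[OF assms(1), of _ b]) auto
    define s where "s = Max (collision_times {a<..<b})"
    have s: "s \<in> collision_times {a<..<b}" using fin False by (simp add: s_def)
    then have asb: "a < s" "s < b" by (auto simp: collision_times_def)
    have "collision_times {a<..<s} \<subset> collision_times {a<..<b}"
      using s asb by (auto simp: collision_times_def)
    then have "card (collision_times {a<..<s}) < card (collision_times {a<..<b})"
      using fin by (rule psubset_card_mono[rotated])
    note IH = less.hyps[OF this asb(1)]
    have "t \<notin> collision_times {s<..<b}" for t
    proof
      assume t: "t \<in> collision_times {s<..<b}"
      then have "t \<in> collision_times {a<..<b}" using asb by (auto simp: collision_times_def)
      then have "t \<le> s" using fin by (simp add: s_def)
      then show False using t by (simp add: collision_times_def)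
    qed
    then have "collision_times {s<..<b} = {}" by blast
    note last = step[OF less_imp_le[OF asb(1)] asb(2) this]
    have "collision_times {a<..b} = collision_times {a<..s} \<union> collision_times {s<..b}"
      using asb by (auto simp: collision_times_def)
    moreover have "finite (collision_times {a<..s})" "finite (collision_times {s<..b})"
      using assms(1) asb by (auto intro!: finite_collision_times)
    ultimately have "(\<Sum>t\<in>collision_times {a<..b}. jump_sum \<Omega> N r x u t)
        = (\<Sum>t\<in>collision_times {a<..s}. jump_sum \<Omega> N r x u t) + (\<Sum>t\<in>collision_times {s<..b}. jump_sum \<Omega> N r x u t)"
      by (simp add: sum.union_disjoint collision_times_def disjoint_iff)
    then show ?thesis using IH last by (simp add: algebra_simps)
  qed
qed

text \<open>Cauchy-Schwarz bounds the sum of the speeds by the root mean square velocity.\<close>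

lemma virial_bound:
  fixes ubar :: real
  assumes E: "(\<Sum>i<N. (norm (u i t))\<^sup>2) = N * ubar\<^sup>2" and "ubar \<ge> 0"
  shows "\<bar>virial t\<bar> \<le> (N + 2 * N * B) * (N * ubar)"
proof -
  have "norm (field t i) \<le> N + 2 * N * B" for i
  proof -
    have "norm (field t i) \<le> norm (repulsion N (\<lambda>k. x k t) i) + norm ((2 * real N) *\<^sub>R V (x i t))"
      unfolding field_def by (rule norm_triangle_ineq)
    also have "\<dots> \<le> N + 2 * N * B"
      using norm_repulsion_le field_bound by (intro add_mono) (auto intro!: mult_left_mono)
    finally show ?thesis .
  qed
  then have "\<bar>u i t \<bullet> field t i\<bar> \<le> norm (u i t) * (N + 2 * N * B)" for i
    using Cauchy_Schwarz_ineq2[of "u i t" "field t i"] by (meson mult_left_mono norm_ge_zero order_trans)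
  then have "\<bar>virial t\<bar> \<le> (\<Sum>i<N. norm (u i t) * (N + 2 * N * B))"
    unfolding virial_def by (intro order_trans[OF sum_abs] sum_mono) auto
  also have "\<dots> = (N + 2 * N * B) * (\<Sum>i<N. norm (u i t))"
    by (simp add: sum_distrib_right mult.commute)
  also have "\<dots> \<le> (N + 2 * N * B) * (N * ubar)"
  proof (rule mult_left_mono)
    have "(\<Sum>i<N. norm (u i t) * 1)\<^sup>2 \<le> (\<Sum>i<N. (norm (u i t))\<^sup>2) * (\<Sum>i<N. 1\<^sup>2)"
      by (rule Cauchy_Schwarz_ineq_sum)
    also have "\<dots> = (N * ubar)\<^sup>2" using E by (simp add: power2_eq_square mult_ac)
    finally have "(\<Sum>i<N. norm (u i t))\<^sup>2 \<le> (N * ubar)\<^sup>2" by simp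
    then show "(\<Sum>i<N. norm (u i t)) \<le> N * ubar"
      by (rule power2_le_imp_le) (use \<open>ubar \<ge> 0\<close> in simp)
    have "B \<ge> 0" using field_bound[of 0] norm_ge_zero order_trans by blast
    then show "0 \<le> N + 2 * N * B" by simp
  qed
  finally show ?thesis .
qed

lemma collision_sum_le:
  fixes ubar :: real
  assumes E: "(\<Sum>i<N. (norm (u i 0))\<^sup>2) = N * ubar\<^sup>2" and "ubar \<ge> 0" and t: "t \<ge> 0" and T: "T > 0"
  shows "collision_sum \<Omega> N r x u t (t + T)
    \<le> 2 * (N + 2 * N * B) * (N * ubar) + 2 * N * \<Lambda> * T * (N * ubar\<^sup>2)"
proof -
  have en: "(\<Sum>i<N. (norm (u i t'))\<^sup>2) = N * ubar\<^sup>2" if "t' \<ge> 0" for t'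
    using energy_and_virial[of 0 t'] E that by (cases "t' = 0") auto
  have "collision_sum \<Omega> N r x u t (t + T) = (\<Sum>s\<in>collision_times {t<..<t + T}. jump_sum \<Omega> N r x u s)"
    unfolding collision_sum_eq[OF generic t]
    by (intro sum.cong) (auto simp: collision_times_def)
  also have "\<dots> \<le> (\<Sum>s\<in>collision_times {t<..t + T}. jump_sum \<Omega> N r x u s)"
    by (rule sum_mono2[OF finite_collision_times[OF t order_refl]])
      (auto simp: jump_sum_nonneg collision_times_def)
  also have "\<dots> \<le> virial (t + T) - virial t + 2 * N * \<Lambda> * T * (N * ubar\<^sup>2)"
    using energy_and_virial[OF t, of "t + T"] T en[OF t] by simp
  also have "\<dots> \<le> 2 * (N + 2 * N * B) * (N * ubar) + 2 * N * \<Lambda> * T * (N * ubar\<^sup>2)"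
  proof -
    have "0 \<le> t + T" using t T by simp
    then have "virial (t + T) - virial t \<le> 2 * ((N + 2 * N * B) * (N * ubar))"
      using virial_bound[OF en[OF t] \<open>ubar \<ge> 0\<close>] virial_bound[OF en \<open>ubar \<ge> 0\<close>, of "t + T"]
      unfolding abs_le_iff by linarith
    then show ?thesis by (simp only: mult.assoc add_le_cancel_right)
  qed
  finally show ?thesis .
qed

end

section \<open>The bound on the velocity jumps\<close>

theorem theorem1p4:
  shows "\<exists>(\<kappa> :: real) (c :: real). \<kappa> > 0 \<and> c > 0 \<and>
    (\<forall>(\<Omega> :: (real ^ 'd) set) (N :: nat) (r :: real) (m :: real)
       (x :: nat \<Rightarrow> real \<Rightarrow> real ^ 'd) (u :: nat \<Rightarrow> real \<Rightarrow> real ^ 'd)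
       (K :: real) (E :: real) (ubar :: real) (Tf :: real).
      open \<Omega> \<and> connected \<Omega> \<and> bounded \<Omega> \<and> C3_boundary \<Omega> \<and>
      r > 0 \<and> m > 0 \<and> r < reach (frontier \<Omega>) \<and>
      hard_spheres \<Omega> N r x u \<and> generic_collisions \<Omega> N r x \<and>
      K = K_const (frontier \<Omega>) (outer_normal \<Omega>) \<and>
      E = kinetic_energy m N u 0 \<and> E > 0 \<and>
      ubar = sqrt (2 * E / (real N * m)) \<and>
      Tf = 1 / (K * ubar) \<and>
      real N * r * K < \<kappa>
      \<longrightarrow> (\<forall>t\<ge>0. collision_sum \<Omega> N r x u t (t + Tf) \<le> c * real N ^ 2 * ubar))"
proof -
  define d where "d = real DIM(real ^ 'd)"
  have d: "d \<ge> 1" by (simp add: d_def)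
  \<comment> \<open>The field \<open>V\<close> has norm at most \<open>d\<close> and Lipschitz constant \<open>4 d / L \<le> 4 d K\<close>, both with a factor
     \<open>d\<close> from the extension by coordinates. With this \<open>\<kappa>\<close> the field varies little over the size of a
     particle. In \<open>c\<close>, the part \<open>2 + 4 d\<close> bounds the virial at the two end points and \<open>8 d\<close> its loss
     during flight.\<close>
  define \<kappa> where "\<kappa> = 1 / (16 * d)"
  define c where "c = 2 + 12 * d"
  have "\<kappa> > 0" "c > 0" using d by (simp_all add: \<kappa>_def c_def)
  moreover have "collision_sum \<Omega> N r x u t (t + Tf) \<le> c * real N ^ 2 * ubar"
    if \<Omega>: "open \<Omega>" "bounded \<Omega>" "C3_boundary \<Omega>"
      and r: "r > 0" "r < reach (frontier \<Omega>)" and m: "m > 0"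
      and hs: "hard_spheres \<Omega> N r x u" "generic_collisions \<Omega> N r x"
      and K: "K = K_const (frontier \<Omega>) (outer_normal \<Omega>)"
      and E: "E = kinetic_energy m N u 0" "E > 0"
      and ubar: "ubar = sqrt (2 * E / (real N * m))" and Tf: "Tf = 1 / (K * ubar)"
      and small: "real N * r * K < \<kappa>" and t: "t \<ge> 0"
    for \<Omega> :: "(real ^ 'd) set" and N r m x u K E ubar Tf t
  proof -
    define L where "L = reach (frontier \<Omega>)"
    define \<Lambda> where "\<Lambda> = d * (4 / L)"
    have L: "L > 0" using r by (simp add: L_def)
    have KL: "1 / L \<le> K" unfolding K K_const_def L_def by simp
    have Kpos: "K > 0" using KL L by (meson less_le_trans zero_less_divide_1_iff)
    \<comment> \<open>A positive energy requires a particle.\<close>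
    have N: "N \<ge> 1" using E by (cases "N = 0") (auto simp: kinetic_energy_def)
    have rK: "r * K \<le> real N * r * K" using N r Kpos by (simp add: mult_le_cancel_right1)
    have "16 * (real N * r * K) \<le> 16 * d * (real N * r * K)"
      using d N r Kpos by (intro mult_right_mono) auto
    also have sm: "16 * d * (real N * r * K) < 1"
      using small d by (simp add: \<kappa>_def pos_less_divide_eq mult_ac)
    finally have "16 * (r * K) < 1" using rK by linarith
    moreover have "r / L \<le> r * K" using KL r by (simp add: divide_inverse)
    ultimately have "r / L \<le> 1 / 4" by linarith
    then have r4: "r \<le> L / 4" using L by (simp add: field_simps)
    obtain V where V: "\<And>x. norm (V x) \<le> d" "\<And>x y. norm (V x - V y) \<le> \<Lambda> * dist x y"
      "\<And>x q. \<lbrakk>ball x r \<subseteq> \<Omega>; q \<in> frontier \<Omega>; dist x q = r\<rbrakk> \<Longrightarrow>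
        norm (V x) = 1 \<and> x - q = r *\<^sub>R V x \<and> outer_normal \<Omega> q = - V x"
      using inward_normal_field[OF \<Omega> r(1) r4[unfolded L_def]] unfolding \<Lambda>_def L_def d_def by blast
    have \<Lambda>K: "\<Lambda> \<le> 4 * d * K" using mult_left_mono[OF KL, of "4 * d"] d by (simp add: \<Lambda>_def mult_ac)
    have \<Lambda>0: "\<Lambda> \<ge> 0" using L d by (simp add: \<Lambda>_def)
    have "4 * N * r * \<Lambda> \<le> 4 * N * r * (4 * d * K)" using \<Lambda>K r by (intro mult_left_mono) auto
    also have "\<dots> \<le> 1" using sm by (simp add: mult_ac)
    finally have small': "4 * N * r * \<Lambda> \<le> 1" .
    interpret hard_spheres_with_normal_field \<Omega> N r x u V d \<Lambda>
      using \<Omega>(1) r(1) hs V small' \<Lambda>0 by unfold_locales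
    have up: "ubar > 0" using E N m by (simp add: ubar)
    have en: "(\<Sum>i<N. (norm (u i 0))\<^sup>2) = N * ubar\<^sup>2"
    proof -
      have "2 * E = m * (\<Sum>i<N. (norm (u i 0))\<^sup>2)" using E(1) by (simp add: kinetic_energy_def)
      moreover have "ubar\<^sup>2 = 2 * E / (real N * m)" using E m by (simp add: ubar)
      ultimately show ?thesis using N m by simp
    qed
    have "Tf > 0" using Kpos up by (simp add: Tf)
    then have "collision_sum \<Omega> N r x u t (t + Tf)
        \<le> 2 * (N + 2 * N * d) * (N * ubar) + 2 * N * \<Lambda> * Tf * (N * ubar\<^sup>2)"
      using en up t by (intro collision_sum_le) auto
    also have "2 * N * \<Lambda> * Tf * (N * ubar\<^sup>2) \<le> 2 * N * (4 * d * K) * Tf * (N * ubar\<^sup>2)"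
      using \<Lambda>K \<open>Tf > 0\<close> by (intro mult_right_mono mult_left_mono) auto
    also have "\<dots> = 8 * d * (real N)\<^sup>2 * ubar"
      using Kpos up by (simp add: Tf power2_eq_square)
    finally show ?thesis by (simp add: c_def power2_eq_square algebra_simps)
  qed
  ultimately show ?thesis by blast
qed

end
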